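(* Let $r\ge 3$, $t\ge 2$ and $k\ge 2(t-1)(r-2)+2$ be integers. Then, as $n\to\infty$, $$ex_r(n,\mathbb{H}_t^rP_k)=(t-1-o(1))\binom{n}{2},\qquad ex_r(n,\mathbb{B}_t^rP_k)=(t-1-o(1))\binom{n}{2},$$ and $$ex_r(n,\mathbb{H}_t^rC_{k-1})=(t-1-o(1))\binom{n}{2},\qquad ex_r(n,\mathbb{B}_t^rC_{k-1})=(t-1-o(1))\binom{n}{2}.$$
   Context: $P_k$ denotes the path on $k$ vertices and $C_{\ell}$ the cycle on $\ell$ vertices. A hypergraph consists of a finite vertex set and a set of distinct subsets of it (hyperedges); it is $r$-uniform if all hyperedges have size $r$. For an integer $t\ge1$ and a graph $F$, a hypergraph $\mathcal{F}$ is a $t$-heavy copy of $F$ if there exist an injection $i:V(F)\to V(\mathcal{F})$ and a map $h$ assigning to each edge $e$ of $F$ a set $h(e)$ of $t$ distinct hyperedges of $\mathcal{F}$ such that for every edge $e=xy$ of $F$, $\{i(x),i(y)\}\subseteq A$ for all $A\in h(e)$. It is a $t$-wise Berge copy of $F$ if moreover $|E(\mathcal{F})|=t|E(F)|$ and such $i,h$ exist with $h(e)\cap h(e')=\emptyset$ for distinct edges $e,e'$ of $F$. $\mathbb{H}_t^rF$ and $\mathbb{B}_t^rF$ denote the families of $r$-uniform $t$-heavy copies and $r$-uniform $t$-wise Berge copies of $F$, respectively. $ex_r(n,\mathbb{F})$ is the maximum number of hyperedges in an $r$-uniform hypergraph on $n$ vertices containing no member of $\mathbb{F}$ as a subhypergraph.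 *)

theory Defs
  imports Complex_Main "HOL-Library.Landau_Symbols"
begin

record 'a hypergraph =
  verts :: "'a set"
  edges :: "'a set set"

definition hypergraph :: "'a hypergraph \<Rightarrow> bool" where
  "hypergraph H \<longleftrightarrow> finite (verts H) \<and> edges H \<subseteq> Pow (verts H)"

definition uniform :: "nat \<Rightarrow> 'a hypergraph \<Rightarrow> bool" where
  "uniform r H \<longleftrightarrow> hypergraph H \<and> (\<forall>A\<in>edges H. card A = r)"

text \<open>A finite simple graph is a 2-uniform hypergraph.\<close>

definition path_graph :: "nat \<Rightarrow> nat hypergraph" where
  "path_graph k = \<lparr>verts = {..<k}, edges = {{i, Suc i} | i. Suc i < k}\<rparr>"

text \<open>Only for \<open>l \<ge> 3\<close> is this the cycle on \<open>l\<close> vertices: \<open>l = 1\<close> yields a loop and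
  \<open>l = 2\<close> a single edge.\<close>

definition cycle_graph :: "nat \<Rightarrow> nat hypergraph" where
  "cycle_graph l = \<lparr>verts = {..<l}, edges = {{i, Suc i mod l} | i. i < l}\<rparr>"

text \<open>\<open>i\<close> and \<open>h\<close> are only relevant on the vertices and on the edges of \<open>F\<close>, respectively.
  Infinite sets have cardinality 0, so \<open>card (h e) = t\<close> is the intended condition for all
  \<open>t\<close> because \<open>edges H\<close> is finite.\<close>

definition heavy_witness ::
  "nat \<Rightarrow> 'a hypergraph \<Rightarrow> 'b hypergraph \<Rightarrow> ('a \<Rightarrow> 'b) \<Rightarrow> ('a set \<Rightarrow> 'b set set) \<Rightarrow> bool" where
  "heavy_witness t F H i h \<longleftrightarrow>
     inj_on i (verts F) \<and> i ` verts F \<subseteq> verts H \<and>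
     (\<forall>e\<in>edges F. h e \<subseteq> edges H \<and> card (h e) = t) \<and>
     (\<forall>x y. {x, y} \<in> edges F \<longrightarrow> (\<forall>A\<in>h {x, y}. {i x, i y} \<subseteq> A))"

definition heavy_copy :: "nat \<Rightarrow> 'a hypergraph \<Rightarrow> 'b hypergraph \<Rightarrow> bool" where
  "heavy_copy t F H \<longleftrightarrow> hypergraph H \<and> (\<exists>i h. heavy_witness t F H i h)"

definition berge_copy :: "nat \<Rightarrow> 'a hypergraph \<Rightarrow> 'b hypergraph \<Rightarrow> bool" where
  "berge_copy t F H \<longleftrightarrow> hypergraph H \<and> card (edges H) = t * card (edges F) \<and>
     (\<exists>i h. heavy_witness t F H i h \<and>
        (\<forall>e\<in>edges F. \<forall>e'\<in>edges F. e \<noteq> e' \<longrightarrow> h e \<inter> h e' = {}))"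

text \<open>Vertices are natural numbers throughout: every finite hypergraph is isomorphic to one
  of this kind, and containment below is up to isomorphism.\<close>

definition heavy_family :: "nat \<Rightarrow> nat \<Rightarrow> 'a hypergraph \<Rightarrow> nat hypergraph set" where
  "heavy_family r t F = {H. uniform r H \<and> heavy_copy t F H}"

definition berge_family :: "nat \<Rightarrow> nat \<Rightarrow> 'a hypergraph \<Rightarrow> nat hypergraph set" where
  "berge_family r t F = {H. uniform r H \<and> berge_copy t F H}"

definition contains :: "'b hypergraph \<Rightarrow> 'a hypergraph \<Rightarrow> bool" where
  "contains H G \<longleftrightarrow>
     (\<exists>f. inj_on f (verts G) \<and> f ` verts G \<subseteq> verts H \<and> (`) f ` edges G \<subseteq> edges H)"

definition ex :: "nat \<Rightarrow> nat \<Rightarrow> nat hypergraph set \<Rightarrow> nat" where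
  "ex r n \<F> = Max {card (edges H) | H :: nat hypergraph.
     uniform r H \<and> card (verts H) = n \<and> (\<forall>G\<in>\<F>. \<not> contains H G)}"

text \<open>The set under \<open>Max\<close> is always finite, and it is nonempty if every member of the family
  has a hyperedge, so for such families \<open>ex\<close> is a genuine maximum.\<close>

lemma finite_ex_set:
  "finite {card (edges H) | H :: nat hypergraph.
     uniform r H \<and> card (verts H) = n \<and> (\<forall>G\<in>\<F>. \<not> contains H G)}" (is "finite ?S")
proof (rule finite_subset)
  show "?S \<subseteq> {..2 ^ n}"
  proof
    fix m assume "m \<in> ?S"
    then obtain H :: "nat hypergraph" where H: "m = card (edges H)" "uniform r H" "card (verts H) = n"
      by blast
    then have "card (edges H) \<le> card (Pow (verts H))"
      by (intro card_mono) (auto simp: uniform_def hypergraph_def)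
    with H show "m \<in> {..2 ^ n}"
      by (simp add: card_Pow uniform_def hypergraph_def)
  qed
qed simp

lemma ex_set_nonempty:
  assumes "\<And>G. G \<in> \<F> \<Longrightarrow> edges G \<noteq> {}"
  shows "{card (edges H) | H :: nat hypergraph.
     uniform r H \<and> card (verts H) = n \<and> (\<forall>G\<in>\<F>. \<not> contains H G)} \<noteq> {}"
proof -
  let ?H = "\<lparr>verts = {..<n}, edges = {}\<rparr> :: nat hypergraph"
  have "uniform r ?H \<and> card (verts ?H) = n \<and> (\<forall>G\<in>\<F>. \<not> contains ?H G)"
    using assms by (auto simp: uniform_def hypergraph_def contains_def)
  then show ?thesis by blast
qed

end

theory Submission
  imports Defs "HOL-Library.FuncSet" "HOL-Real_Asymp.Real_Asymp"
begin

text \<open>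
  Lower bound: join \<open>t - 1\<close> disjoint blocks of \<open>r - 2\<close> vertices to all pairs outside the blocks. A pair
  outside lies in only \<open>t - 1\<close> hyperedges, so the \<open>(t - 1) * (r - 2)\<close> block vertices cover all edges of
  a heavy copy, which is impossible for a path or cycle with more than twice as many edges.

  Upper bound: a Berge cycle on \<open>k\<close> vertices contains a Berge path on \<open>k\<close> vertices, so only cycles of
  length \<open>l \<ge> 4\<close> and the triangle for \<open>r = 3\<close>, \<open>t = 2\<close> matter. Call a pair heavy if its codegree is at
  least \<open>t\<close>. A dense graph contains a large complete bipartite graph, hence an even cycle avoiding
  boundedly many vertices prescribed for each edge; such a cycle of heavy pairs extends to disjoint
  choices of hyperedges. For even \<open>l\<close> this leaves only \<open>o(n\<^sup>2)\<close> heavy pairs. For odd \<open>l \<ge> 5\<close>, all but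
  \<open>o(n\<^sup>2)\<close> heavy pairs \<open>xy\<close> are joined by well-behaved paths with \<open>l - 2\<close> edges, which a third vertex
  \<open>z\<close> of a hyperedge closes to a Berge cycle unless fewer than \<open>2 * t\<close> hyperedges lie over \<open>xz\<close>
  or \<open>yz\<close>. So almost every hyperedge contains a pair that is not heavy or has all codegrees below
  \<open>2 * t\<close>. Giving a pair weight 1 in the first case and 1/3 in the second bounds the number of
  hyperedges by \<open>t - 1\<close> per pair, since \<open>(2 * t - 1) / 3 \<le> t - 1\<close> for \<open>t \<ge> 2\<close>.
\<close>

section \<open>Even cycles in dense graphs\<close>

text \<open>A weak Kovari-Sos-Turan theorem by pigeonhole. Fix \<open>m\<close> vertices of high
  degree as \<open>S\<close>. Counting edges at \<open>S\<close> leaves more than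
  \<open>2 ^ m * s\<close> vertices with at least \<open>s\<close> neighbours in \<open>S\<close>,
  so some subset of \<open>S\<close> is the exact trace of the neighbourhoods of \<open>s\<close> of
  them.\<close>

lemma complete_bipartite_of_dense:
  fixes \<epsilon> :: real and s :: nat
  assumes "\<epsilon> > 0"
  shows "\<exists>n0. \<forall>V :: 'a set. \<forall>D. finite V \<longrightarrow> n0 \<le> card V \<longrightarrow> (\<forall>e\<in>D. e \<subseteq> V \<and> card e = 2) \<longrightarrow>
     \<epsilon> * (real (card V))\<^sup>2 < card D \<longrightarrow>
     (\<exists>X Y. X \<subseteq> V \<and> Y \<subseteq> V \<and> X \<inter> Y = {} \<and> card X = s \<and> card Y = s \<and> (\<forall>x\<in>X. \<forall>y\<in>Y. {x, y} \<in> D))"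
proof -
  \<comment> \<open>Large enough that vertices with at most \<open>s\<close> neighbours in
    \<open>S\<close> absorb at most half of the \<open>m * (\<epsilon> / 2 * n)\<close> incidences
    with \<open>S\<close>.\<close>
  define m where "m = nat \<lceil>4 * real s / \<epsilon>\<rceil> + 1"
  have m: "real m \<ge> 4 * real s / \<epsilon>" "m > 0" unfolding m_def by linarith+
  then have ms: "\<epsilon> * m \<ge> 4 * s" using assms by (simp add: field_simps)
  \<comment> \<open>The summand \<open>2 * m\<close> secures \<open>m\<close> vertices of high
    degree; the summand with factor 4 makes \<open>Y0\<close> larger than
    \<open>2 ^ m * s\<close>.\<close>
  define n0 where "n0 = nat \<lceil>(2 * m + 2 + 4 * (m + 2 ^ m * s + 1)) / \<epsilon>\<rceil>"
  show ?thesis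
  proof (intro exI[of _ n0] allI impI)
    fix V :: "'a set" and D
    assume V: "finite V" and n0: "n0 \<le> card V" and D: "\<forall>e\<in>D. e \<subseteq> V \<and> card e = 2"
      and dense: "\<epsilon> * (real (card V))\<^sup>2 < card D"
    define n where "n = card V"
    have "real n \<ge> (2 * m + 2 + 4 * (m + 2 ^ m * s + 1)) / \<epsilon>"
      using n0 unfolding n0_def n_def by linarith
    then have n: "\<epsilon> * n \<ge> 2 * m + 2 + 4 * (m + 2 ^ m * s + 1)"
      using assms by (simp add: field_simps)
    moreover have "real (2 * m + 2 + 4 * (m + 2 ^ m * s + 1)) > 0" by (simp add: add_pos_nonneg)
    ultimately have npos: "n > 0" by (intro gr0I) auto
    define N where "N v = {u\<in>V. {u, v} \<in> D}" for v
    have finN: "finite (N v)" for v unfolding N_def using V by simp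
    have Nle: "card (N v) \<le> n" for v
      unfolding n_def N_def by (rule card_mono[OF V]) auto
    have "D \<subseteq> (\<lambda>(v, u). {u, v}) ` (SIGMA v:V. N v)"
    proof
      fix e assume e: "e \<in> D"
      with D obtain u v where "e = {u, v}" by (metis card_2_iff)
      with e D show "e \<in> (\<lambda>(v, u). {u, v}) ` (SIGMA v:V. N v)"
        by (intro image_eqI[of _ _ "(v, u)"]) (auto simp: N_def)
    qed
    then have "card D \<le> card (SIGMA v:V. N v)"
      using V finN by (intro surj_card_le) auto
    then have sumD: "card D \<le> (\<Sum>v\<in>V. card (N v))" using V finN by simp
    define High where "High = {v\<in>V. real (card (N v)) \<ge> \<epsilon> / 2 * n}"
    have finH: "finite High" using V High_def by simp
    have "real (card D) \<le> (\<Sum>v\<in>V. real (card (N v)))" using sumD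
      by (metis of_nat_le_iff of_nat_sum)
    also have "\<dots> \<le> (\<Sum>v\<in>V. (if v \<in> High then real n else 0) + \<epsilon> / 2 * n)"
      using Nle assms by (intro sum_mono) (auto simp: High_def intro: add_increasing2)
    also have "\<dots> = card High * real n + n * (\<epsilon> / 2 * n)"
      using V by (simp add: sum.distrib sum.If_cases High_def n_def Int_def)
    finally have "\<epsilon> * n * n < card High * real n + n * (\<epsilon> / 2 * n)"
      using dense by (simp add: n_def power2_eq_square)
    then have "(\<epsilon> / 2 * n) * n < card High * real n" by (simp add: algebra_simps)
    then have "\<epsilon> / 2 * n < card High" using npos by simp
    moreover have "\<epsilon> / 2 * n \<ge> m"
    proof -
      have "real (2 * m) \<le> real (2 * m + 2 + 4 * (m + 2 ^ m * s + 1))" by (rule of_nat_mono) simp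
      from order_trans[OF this n] show ?thesis by simp
    qed
    ultimately have "m \<le> card High" by linarith
    then obtain S where S: "S \<subseteq> High" "card S = m" "finite S"
      by (meson obtain_subset_with_card_n)
    have SV: "S \<subseteq> V" using S High_def by auto
    define Y0 where "Y0 = {y\<in>V - S. card (N y \<inter> S) \<ge> s}"
    have finY: "finite Y0" using V Y0_def by simp
    have sym: "u \<in> N v \<longleftrightarrow> v \<in> N u" if "u \<in> V" "v \<in> V" for u v
      using that by (auto simp: N_def insert_commute)
    have "(SIGMA v:S. N v) = (\<lambda>(y, v). (v, y)) ` (SIGMA y:V. N y \<inter> S)"
      using sym SV by (force simp: N_def image_iff)
    then have "card (SIGMA v:S. N v) = card (SIGMA y:V. N y \<inter> S)"
      by (simp add: card_image inj_on_def)
    then have swap: "(\<Sum>v\<in>S. card (N v)) = (\<Sum>y\<in>V. card (N y \<inter> S))"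
      using V finN S by simp
    have "m * (\<epsilon> / 2 * n) = (\<Sum>v\<in>S. \<epsilon> / 2 * n)" using S by simp
    also have "\<dots> \<le> (\<Sum>v\<in>S. real (card (N v)))"
      using S by (intro sum_mono) (auto simp: High_def)
    also have "\<dots> = (\<Sum>y\<in>V. real (card (N y \<inter> S)))" using swap
      by (metis of_nat_sum)
    also have "\<dots> \<le> (\<Sum>y\<in>V. (if y \<in> Y0 then real m else 0) + ((if y \<in> S then real m else 0) + s))"
    proof (rule sum_mono)
      fix y assume "y \<in> V"
      have "card (N y \<inter> S) \<le> m" using S by (metis card_mono inf_le2)
      then show "real (card (N y \<inter> S)) \<le> (if y \<in> Y0 then real m else 0) + ((if y \<in> S then real m else 0) + s)"
        using \<open>y \<in> V\<close> by (auto simp: Y0_def)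
    qed
    also have "\<dots> = card Y0 * real m + (card S * real m + n * real s)"
    proof -
      have "V \<inter> Y0 = Y0" "V \<inter> S = S" using SV Y0_def by auto
      then show ?thesis using V
        by (simp add: sum.distrib sum.If_cases n_def Int_def)
    qed
    finally have "m * (\<epsilon> / 2 * n) \<le> card Y0 * real m + (m * real m + n * real s)" using S by simp
    moreover have "n * real s \<le> m * (\<epsilon> / 4 * n)"
    proof -
      have "n * real s \<le> n * (\<epsilon> * m / 4)" using ms by (intro mult_left_mono) auto
      then show ?thesis by (simp add: algebra_simps)
    qed
    ultimately have "m * (\<epsilon> / 4 * n) \<le> m * (card Y0 + real m)" by (simp add: algebra_simps)
    then have "\<epsilon> / 4 * n \<le> card Y0 + real m" using \<open>m > 0\<close> by simp
    moreover have "\<epsilon> / 4 * n \<ge> m + 2 ^ m * s + 1"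
      using n by (simp add: field_simps)
    ultimately have big: "real (card Y0) > 2 ^ m * real s" by simp
    have "\<exists>B\<in>Pow S. s \<le> card {y\<in>Y0. N y \<inter> S = B}"
    proof (rule ccontr)
      assume "\<not> ?thesis"
      have less: "card {y\<in>Y0. N y \<inter> S = B} \<le> s" if "B \<in> Pow S" for B
      proof (rule ccontr)
        assume "\<not> ?thesis"
        then have "s \<le> card {y\<in>Y0. N y \<inter> S = B}" by linarith
        with \<open>\<not> (\<exists>B\<in>Pow S. s \<le> card {y\<in>Y0. N y \<inter> S = B})\<close> that show False by blast
      qed
      have Y0: "(\<Union>B\<in>Pow S. {y\<in>Y0. N y \<inter> S = B}) = Y0"
      proof (intro equalityI subsetI)
        fix y assume "y \<in> Y0"
        then show "y \<in> (\<Union>B\<in>Pow S. {y\<in>Y0. N y \<inter> S = B})"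
          by (intro UN_I[of "N y \<inter> S"]) simp_all
      qed simp
      have "card (\<Union>B\<in>Pow S. {y\<in>Y0. N y \<inter> S = B}) \<le> (\<Sum>B\<in>Pow S. card {y\<in>Y0. N y \<inter> S = B})"
        using S by (intro card_UN_le) simp
      also have "\<dots> \<le> (\<Sum>B\<in>Pow S. s)" by (rule sum_mono) (rule less)
      also have "\<dots> = 2 ^ m * s" using S by (simp add: card_Pow)
      finally have "real (card Y0) \<le> real (2 ^ m * s)" unfolding Y0 by (rule of_nat_mono)
      with big show False by simp
    qed
    then obtain B where B: "B \<subseteq> S" "s \<le> card {y\<in>Y0. N y \<inter> S = B}" by auto
    show "\<exists>X Y. X \<subseteq> V \<and> Y \<subseteq> V \<and> X \<inter> Y = {} \<and> card X = s \<and> card Y = s \<and> (\<forall>x\<in>X. \<forall>y\<in>Y. {x, y} \<in> D)"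
    proof (cases "s = 0")
      case True
      then show ?thesis by (intro exI[of _ "{}"]) auto
    next
      case False
      obtain Y where Y: "Y \<subseteq> {y\<in>Y0. N y \<inter> S = B}" "card Y = s"
        using B by (meson obtain_subset_with_card_n)
      with False obtain y where "y \<in> Y" by (metis card.empty ex_in_conv)
      with Y have "s \<le> card B" by (auto simp: Y0_def)
      then obtain X where X: "X \<subseteq> B" "card X = s" by (meson obtain_subset_with_card_n)
      have "{x, y} \<in> D" if "x \<in> X" "y \<in> Y" for x y
      proof -
        have "x \<in> N y" using that X Y by auto
        then show ?thesis by (simp add: N_def)
      qed
      moreover have "X \<subseteq> V" "Y \<subseteq> V" "X \<inter> Y = {}"
        using X Y B SV by (auto simp: Y0_def)
      ultimately show ?thesis using X Y by blast
    qed
  qed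
qed

text \<open>Once the coordinates other than \<open>m\<close> are fixed, so is the forbidden set, and
  at most \<open>c\<close> values at \<open>m\<close> fall into it. This is one term of the union
  bound in \<open>even_cycle_avoiding\<close>.\<close>

lemma card_PiE_avoid_le:
  fixes \<Phi> :: "('a \<Rightarrow> 'b) \<Rightarrow> 'b set"
  assumes I: "finite I" "m \<in> I" and F: "\<And>i. i \<in> I \<Longrightarrow> finite (F i) \<and> card (F i) = s"
    and \<Phi>: "\<And>f. f \<in> PiE I F \<Longrightarrow> \<Phi> (restrict f (I - {m})) = \<Phi> f"
    and c: "\<And>f. f \<in> PiE I F \<Longrightarrow> finite (\<Phi> f) \<and> card (\<Phi> f) \<le> c"
  shows "card {f \<in> PiE I F. f m \<in> \<Phi> f} \<le> c * s ^ (card I - 1)"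
proof -
  \<comment> \<open>Restriction replaces the value at \<open>m\<close> by \<open>undefined\<close>;
    by the hypothesis on \<open>\<Phi>\<close> the forbidden set survives this.\<close>
  let ?R = "(\<lambda>f. restrict f (I - {m})) ` PiE I F"
  have R: "?R \<subseteq> PiE (I - {m}) F" by (auto simp: PiE_iff split: if_splits)
  have finP: "finite (PiE (I - {m}) F)" using I F by (intro finite_PiE) auto
  then have finR: "finite ?R" using R finite_subset by blast
  have cR: "finite (\<Phi> g) \<and> card (\<Phi> g) \<le> c" if "g \<in> ?R" for g
    using that \<Phi> c by auto
  have "{f \<in> PiE I F. f m \<in> \<Phi> f} \<subseteq> (\<lambda>(g, y). g(m := y)) ` (SIGMA g:?R. \<Phi> g)"
  proof
    fix f assume f: "f \<in> {f \<in> PiE I F. f m \<in> \<Phi> f}"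
    have "f = (restrict f (I - {m}))(m := f m)"
      using f I by (auto simp: fun_eq_iff PiE_def extensional_def)
    moreover have "f m \<in> \<Phi> (restrict f (I - {m}))" using f \<Phi> by auto
    ultimately show "f \<in> (\<lambda>(g, y). g(m := y)) ` (SIGMA g:?R. \<Phi> g)"
      using f by (intro image_eqI[of _ _ "(restrict f (I - {m}), f m)"]) auto
  qed
  then have "card {f \<in> PiE I F. f m \<in> \<Phi> f} \<le> card (SIGMA g:?R. \<Phi> g)"
    using finR cR by (intro surj_card_le) auto
  also have "\<dots> = (\<Sum>g\<in>?R. card (\<Phi> g))" using finR cR by simp
  also have "\<dots> \<le> (\<Sum>g\<in>?R. c)" using cR by (intro sum_mono) auto
  also have "\<dots> = card ?R * c" by simp
  also have "\<dots> \<le> card (PiE (I - {m}) F) * c"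
    using R finP by (intro mult_right_mono card_mono) auto
  also have "card (PiE (I - {m}) F) = s ^ (card I - 1)"
    using I F by (simp add: card_PiE)
  finally show ?thesis by (simp add: mult.commute)
qed

text \<open>Count the alternating choices of vertices from the two sides of a large complete
  bipartite graph. Each of at most \<open>L * L\<close> conditions on an edge and a vertex off it
  fails for a fraction of at most \<open>(c + 2) / s\<close> of them, so for large \<open>s\<close>
  one choice meets all conditions.\<close>

lemma even_cycle_avoiding:
  fixes \<epsilon> :: real and c L :: nat
  assumes "\<epsilon> > 0" "even L" "L \<ge> 4"
  shows "\<exists>n0. \<forall>V :: 'a set. \<forall>D. \<forall>\<phi> :: 'a set \<Rightarrow> 'a set. finite V \<longrightarrow> n0 \<le> card V \<longrightarrow> (\<forall>e\<in>D. e \<subseteq> V \<and> card e = 2) \<longrightarrow>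
     \<epsilon> * (real (card V))\<^sup>2 < card D \<longrightarrow> (\<forall>e\<in>D. finite (\<phi> e) \<and> card (\<phi> e) \<le> c) \<longrightarrow>
     (\<exists>v. inj_on v {..<L} \<and> (\<forall>i<L. {v i, v (Suc i mod L)} \<in> D) \<and>
        (\<forall>i<L. \<forall>m<L. m \<noteq> i \<longrightarrow> m \<noteq> Suc i mod L \<longrightarrow> v m \<notin> \<phi> {v i, v (Suc i mod L)}))"
proof -
  define s where "s = L * L * (c + 2) + 1"
  obtain n0 where n0: "\<And>(V :: 'a set) D. finite V \<Longrightarrow> n0 \<le> card V \<Longrightarrow> (\<forall>e\<in>D. e \<subseteq> V \<and> card e = 2) \<Longrightarrow>
     \<epsilon> * (real (card V))\<^sup>2 < card D \<Longrightarrow>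
     (\<exists>X Y. X \<subseteq> V \<and> Y \<subseteq> V \<and> X \<inter> Y = {} \<and> card X = s \<and> card Y = s \<and> (\<forall>x\<in>X. \<forall>y\<in>Y. {x, y} \<in> D))"
    using complete_bipartite_of_dense[OF assms(1), of s] by blast
  show ?thesis
  proof (intro exI[of _ n0] allI impI)
    fix V :: "'a set" and D and \<phi> :: "'a set \<Rightarrow> 'a set"
    assume V: "finite V" "n0 \<le> card V" and D: "\<forall>e\<in>D. e \<subseteq> V \<and> card e = 2"
      and dense: "\<epsilon> * (real (card V))\<^sup>2 < card D" and \<phi>: "\<forall>e\<in>D. finite (\<phi> e) \<and> card (\<phi> e) \<le> c"
    from n0[OF V D dense] obtain X Y where XY: "card X = s" "card Y = s" "X \<subseteq> V" "Y \<subseteq> V"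
      "\<And>x y. x \<in> X \<Longrightarrow> y \<in> Y \<Longrightarrow> {x, y} \<in> D" by blast
    have fin: "finite X" "finite Y" using XY V finite_subset by auto
    define F where "F i = (if even i then X else Y)" for i :: nat
    define P where "P = PiE {..<L} F"
    \<comment> \<open>Adding the ends of an edge to its forbidden set also makes nonadjacent cycle
      vertices distinct, at the price of the summand 2 in \<open>c + 2\<close>.\<close>
    define \<psi> where "\<psi> i f = \<phi> {f i, f (Suc i mod L)} \<union> {f i, f (Suc i mod L)}" for i and f :: "nat \<Rightarrow> 'a"
    \<comment> \<open>Evenness of \<open>L\<close> enters here: the closing edge also runs between
      \<open>X\<close> and \<open>Y\<close>.\<close>
    have par: "even (Suc i mod L) \<longleftrightarrow> odd i" for i
      using assms(2) by (simp add: dvd_mod_iff)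
    have edge: "{f i, f (Suc i mod L)} \<in> D" if "f \<in> P" "i < L" for f i
    proof -
      have "Suc i mod L < L" using assms by simp
      then have "f i \<in> F i" "f (Suc i mod L) \<in> F (Suc i mod L)"
        using that PiE_mem[of f "{..<L}" F] unfolding P_def by blast+
      then show ?thesis using XY(5)[of "f i" "f (Suc i mod L)"] XY(5)[of "f (Suc i mod L)" "f i"] par[of i]
        by (cases "even i") (simp_all add: F_def insert_commute)
    qed
    define Bad where "Bad i m = {f \<in> P. f m \<in> \<psi> i f}" for i m
    have bad: "card (Bad i m) \<le> (c + 2) * s ^ (L - 1)"
      if "i < L" "m < L" "m \<noteq> i" "m \<noteq> Suc i mod L" for i m
    proof -
      have "card {f \<in> PiE {..<L} F. f m \<in> \<psi> i f} \<le> (c + 2) * s ^ (card {..<L} - 1)"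
      proof (rule card_PiE_avoid_le)
        fix f assume f: "f \<in> PiE {..<L} F"
        have "Suc i mod L < L" using assms by simp
        then show "\<psi> i (restrict f ({..<L} - {m})) = \<psi> i f"
          using that by (auto simp: \<psi>_def)
        have e: "{f i, f (Suc i mod L)} \<in> D" using edge f that by (simp add: P_def)
        have "card (\<psi> i f) \<le> card (\<phi> {f i, f (Suc i mod L)}) + card {f i, f (Suc i mod L)}"
          unfolding \<psi>_def by (metis card_Un_le)
        also have "\<dots> \<le> c + 2" using \<phi> D e by (intro add_mono) auto
        finally show "finite (\<psi> i f) \<and> card (\<psi> i f) \<le> c + 2"
          using \<phi> e by (auto simp: \<psi>_def)
      qed (use that fin XY in \<open>auto simp: F_def\<close>)
      then show ?thesis by (simp add: Bad_def P_def)
    qed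
    let ?J = "{(i, m). i < L \<and> m < L \<and> m \<noteq> i \<and> m \<noteq> Suc i mod L}"
    have J: "?J \<subseteq> {..<L} \<times> {..<L}" by auto
    have "card (\<Union>p\<in>?J. Bad (fst p) (snd p)) \<le> (\<Sum>p\<in>?J. card (Bad (fst p) (snd p)))"
      using finite_subset[OF J] by (intro card_UN_le) auto
    also have "\<dots> \<le> (\<Sum>p\<in>?J. (c + 2) * s ^ (L - 1))"
      using bad by (intro sum_mono) (simp only: mem_Collect_eq split: prod.splits, force)
    also have "\<dots> \<le> (L * L) * ((c + 2) * s ^ (L - 1))"
      using card_mono[OF _ J] by (simp add: card_cartesian_product)
    also have "\<dots> < s * s ^ (L - 1)"
      unfolding s_def by (simp add: algebra_simps)
    also have "\<dots> = s ^ L" using assms(3) by (cases L) auto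
    also have "\<dots> = card P"
    proof -
      have "(\<Prod>i<L. card (F i)) = (\<Prod>i<L. s)" using XY by (intro prod.cong) (simp_all add: F_def)
      then show ?thesis unfolding P_def by (simp add: card_PiE)
    qed
    finally have less: "card (\<Union>p\<in>?J. Bad (fst p) (snd p)) < card P" .
    have "finite P" unfolding P_def using fin by (intro finite_PiE) (auto simp: F_def)
    then have "finite (\<Union>p\<in>?J. Bad (fst p) (snd p))"
      using finite_subset[OF J] unfolding Bad_def by (intro finite_UN_I) auto
    from card_mono[OF this, of P] less have "\<not> P \<subseteq> (\<Union>p\<in>?J. Bad (fst p) (snd p))"
      by linarith
    then obtain v where "v \<in> P" "v \<notin> (\<Union>p\<in>?J. Bad (fst p) (snd p))" by blast
    then have v: "v \<in> P" "\<And>i m. i < L \<Longrightarrow> m < L \<Longrightarrow> m \<noteq> i \<Longrightarrow> m \<noteq> Suc i mod L \<Longrightarrow> v m \<notin> \<psi> i v"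
      unfolding Bad_def by auto
    have "inj_on v {..<L}"
    proof (rule inj_onI)
      fix a b assume ab: "a \<in> {..<L}" "b \<in> {..<L}" "v a = v b"
      show "a = b"
      proof (rule ccontr)
        assume "a \<noteq> b"
        \<comment> \<open>Only adjacent vertices are not separated by \<open>\<psi>\<close>; they
          differ because elements of \<open>D\<close> have cardinality 2.\<close>
        with v(2)[of a b] ab have "b = Suc a mod L" by (auto simp: \<psi>_def)
        then have "{v a} \<in> D" using edge[OF v(1), of a] ab by simp
        then show False using D by fastforce
      qed
    qed
    then show "\<exists>v. inj_on v {..<L} \<and> (\<forall>i<L. {v i, v (Suc i mod L)} \<in> D) \<and>
        (\<forall>i<L. \<forall>m<L. m \<noteq> i \<longrightarrow> m \<noteq> Suc i mod L \<longrightarrow> v m \<notin> \<phi> {v i, v (Suc i mod L)})"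
      using v edge by (intro exI[of _ v]) (auto simp: \<psi>_def)
  qed
qed

section \<open>Berge cycles and codegrees\<close>

text \<open>Sets with at least \<open>T\<close> elements are served greedily, after the pairwise disjoint small ones.\<close>

lemma disjoint_subfamily_choice:
  fixes N :: "'i \<Rightarrow> 'a set"
  assumes I: "finite I" and N: "\<And>i. i \<in> I \<Longrightarrow> finite (N i) \<and> t \<le> card (N i)"
    and disj: "\<And>i j. i \<in> I \<Longrightarrow> j \<in> I \<Longrightarrow> i \<noteq> j \<Longrightarrow> card (N i) < T \<Longrightarrow> card (N j) < T \<Longrightarrow> N i \<inter> N j = {}"
    and T: "t * card I \<le> T"
  shows "\<exists>S. \<forall>i\<in>I. S i \<subseteq> N i \<and> card (S i) = t \<and> (\<forall>j\<in>I. i \<noteq> j \<longrightarrow> S i \<inter> S j = {})"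
proof -
  let ?I0 = "{i\<in>I. card (N i) < T}" and ?I1 = "{i\<in>I. T \<le> card (N i)}"
  have "\<exists>S. \<forall>i\<in>?I0 \<union> J. S i \<subseteq> N i \<and> card (S i) = t \<and> (\<forall>j\<in>?I0 \<union> J. i \<noteq> j \<longrightarrow> S i \<inter> S j = {})"
    if "finite J" "J \<subseteq> ?I1" for J
    using that
  proof (induction J rule: finite_induct)
    case empty
    have "\<exists>S\<subseteq>N i. card S = t" if "i \<in> I" for i
      using N[OF that] by (meson obtain_subset_with_card_n)
    then obtain S where S: "\<And>i. i \<in> I \<Longrightarrow> S i \<subseteq> N i \<and> card (S i) = t" by metis
    have "S i \<inter> S j = {}" if "i \<in> ?I0" "j \<in> ?I0" "i \<noteq> j" for i j
      using disj[of i j] S[of i] S[of j] that by blast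
    with S show ?case by (intro exI[of _ S]) simp
  next
    case (insert j J)
    then obtain S where S: "\<forall>i\<in>?I0 \<union> J. S i \<subseteq> N i \<and> card (S i) = t \<and> (\<forall>j\<in>?I0 \<union> J. i \<noteq> j \<longrightarrow> S i \<inter> S j = {})"
      by auto
    let ?K = "?I0 \<union> J" and ?U = "\<Union>i\<in>?I0 \<union> J. S i"
    have j: "j \<in> I" "T \<le> card (N j)" "j \<notin> ?K" using insert by auto
    have K: "?K \<subset> I" "finite ?K" using insert.prems insert.hyps(1) I j(1,3) by (blast, simp)
    have finU: "finite ?U"
    proof (intro finite_UN_I K(2))
      fix i assume "i \<in> ?K"
      then show "finite (S i)" using S N K(1) by (meson finite_subset psubsetD)
    qed
    have "card ?U \<le> (\<Sum>i\<in>?K. card (S i))" using K by (intro card_UN_le)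
    also have "\<dots> = t * card ?K" using S by simp
    finally have "card ?U \<le> t * card ?K" .
    \<comment> \<open>Fewer than \<open>card I\<close> sets have been served, so at least
      \<open>t\<close> of the \<open>T\<close> elements are still free.\<close>
    moreover have "t * Suc (card ?K) \<le> T"
    proof -
      have "Suc (card ?K) \<le> card I" using psubset_card_mono[OF I K(1)] by simp
      then have "t * Suc (card ?K) \<le> t * card I" by (rule mult_le_mono2)
      with T show ?thesis by linarith
    qed
    moreover have "card (N j) - card ?U \<le> card (N j - ?U)" by (rule diff_card_le_card_Diff[OF finU])
    ultimately have "t \<le> card (N j - ?U)" using j by simp
    then obtain B where B: "B \<subseteq> N j - ?U" "card B = t" by (meson obtain_subset_with_card_n)
    have "B \<inter> S i = {}" if "i \<in> ?K" for i using B that by blast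
    with S B j show ?case
      by (intro exI[of _ "S(j := B)"]) (auto simp: Int_commute)
  qed
  from this[of ?I1] obtain S where "\<forall>i\<in>?I0 \<union> ?I1. S i \<subseteq> N i \<and> card (S i) = t \<and>
      (\<forall>j\<in>?I0 \<union> ?I1. i \<noteq> j \<longrightarrow> S i \<inter> S j = {})"
    using I by auto
  moreover have "?I0 \<union> ?I1 = I" by auto
  ultimately show ?thesis by auto
qed

text \<open>Delete hyperedges over a pair of current codegree below \<open>T\<close> until no such pair is left.\<close>

lemma codegree_core:
  assumes "finite D" "finite E" "T * card D < card E"
  shows "\<exists>E'\<subseteq>E. E' \<noteq> {} \<and> (\<forall>p\<in>D. (\<exists>A\<in>E'. p \<subseteq> A) \<longrightarrow> T \<le> card {A\<in>E'. p \<subseteq> A})"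
  using assms
proof (induction "card D" arbitrary: D E)
  case 0
  then show ?case by (intro exI[of _ E]) auto
next
  case (Suc d)
  show ?case
  proof (cases "\<forall>p\<in>D. (\<exists>A\<in>E. p \<subseteq> A) \<longrightarrow> T \<le> card {A\<in>E. p \<subseteq> A}")
    case True
    then show ?thesis using Suc.prems by (intro exI[of _ E]) auto
  next
    case False
    then obtain p where p: "p \<in> D" "card {A\<in>E. p \<subseteq> A} < T" by auto
    let ?E = "E - {A\<in>E. p \<subseteq> A}"
    have d: "d = card (D - {p})" using Suc.hyps(2) p Suc.prems by simp
    have "card {A\<in>E. p \<subseteq> A} + card ?E = card E"
      using Suc.prems(2) card_Diff_subset[of "{A\<in>E. p \<subseteq> A}" E] card_mono[of E "{A\<in>E. p \<subseteq> A}"] by simp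
    moreover have "T + T * d < card E" using Suc.prems(3) unfolding Suc.hyps(2)[symmetric] by simp
    ultimately have "T * card (D - {p}) < card ?E" using p d by simp
    from Suc.hyps(1)[OF d _ _ this] Suc.prems obtain E' where E': "E' \<subseteq> ?E" "E' \<noteq> {}"
      "\<forall>q\<in>D - {p}. (\<exists>A\<in>E'. q \<subseteq> A) \<longrightarrow> T \<le> card {A\<in>E'. q \<subseteq> A}" by auto
    \<comment> \<open>All hyperedges over \<open>p\<close> are gone, so the condition for
      \<open>p\<close> holds vacuously.\<close>
    have "\<not> (\<exists>A\<in>E'. p \<subseteq> A)" using E'(1) by auto
    then have "\<forall>q\<in>D. (\<exists>A\<in>E'. q \<subseteq> A) \<longrightarrow> T \<le> card {A\<in>E'. q \<subseteq> A}"
      using E'(3) by (metis Diff_iff singletonD)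
    then show ?thesis using E'(1,2) by (intro exI[of _ E'] conjI) auto
  qed
qed

text \<open>Some hyperedge over an edge of a short cycle leaves the cycle; insert the new vertex there.\<close>

lemma cycle_of_large_codegrees:
  assumes E: "finite E" "E \<noteq> {}" and A: "\<And>A. A \<in> E \<Longrightarrow> finite A \<and> 3 \<le> card A"
    and T: "\<And>p A. A \<in> E \<Longrightarrow> p \<subseteq> A \<Longrightarrow> card p = 2 \<Longrightarrow> 2 ^ l < card {A\<in>E. p \<subseteq> A}"
    and "3 \<le> l"
  shows "\<exists>v. inj_on v {..<l} \<and> (\<forall>i<l. \<exists>A\<in>E. {v i, v (Suc i mod l)} \<subseteq> A)"
proof -
  have "j \<le> l \<longrightarrow> (\<exists>v. inj_on v {..<j} \<and> (\<forall>i<j. \<exists>A\<in>E. {v i, v (Suc i mod j)} \<subseteq> A))" if "3 \<le> j" for j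
    using that
  proof (induction j rule: dec_induct)
    case base
    from E obtain A where "A \<in> E" by auto
    with A[of A] obtain B where "B \<subseteq> A" "card B = 3" by (meson obtain_subset_with_card_n)
    then obtain x y z where xyz: "x \<in> A" "y \<in> A" "z \<in> A" "x \<noteq> y" "y \<noteq> z" "x \<noteq> z"
      by (auto simp: card_3_iff)
    \<comment> \<open>A single hyperedge serves all three edges of the initial triangle; distinct
      hyperedges are not asked for yet.\<close>
    let ?v = "\<lambda>i::nat. if i = 0 then x else if i = 1 then y else z"
    have "inj_on ?v {..<3}" using xyz by (auto simp: inj_on_def)
    moreover have "{?v i, ?v j} \<subseteq> A" for i j using xyz by auto
    ultimately show ?case using \<open>A \<in> E\<close> by blast
  next
    case (step j)
    show ?case
    proof
      assume j: "Suc j \<le> l"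
      with step obtain v where v: "inj_on v {..<j}" "\<And>i. i < j \<Longrightarrow> \<exists>A\<in>E. {v i, v (Suc i mod j)} \<subseteq> A"
        by auto
      let ?p = "{v (j - 1), v 0}"
      from v(2)[of "j - 1"] step.hyps obtain A0 where A0: "A0 \<in> E" "?p \<subseteq> A0" by auto
      have "v (j - 1) \<noteq> v 0" using inj_onD[OF v(1), of "j - 1" 0] step.hyps by auto
      then have big: "2 ^ l < card {A\<in>E. ?p \<subseteq> A}" using T[OF A0] by simp
      \<comment> \<open>Only \<open>2 ^ j\<close> sets fit into the vertex set of the current
        cycle.\<close>
      have "\<not> {A\<in>E. ?p \<subseteq> A} \<subseteq> Pow (v ` {..<j})"
      proof
        assume "{A\<in>E. ?p \<subseteq> A} \<subseteq> Pow (v ` {..<j})"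
        then have "card {A\<in>E. ?p \<subseteq> A} \<le> card (Pow (v ` {..<j}))" by (intro card_mono) auto
        also have "\<dots> = 2 ^ j" using v(1) by (simp add: card_Pow card_image)
        also have "\<dots> \<le> 2 ^ l" using j by (intro power_increasing) auto
        finally show False using big by simp
      qed
      then obtain A w where A: "A \<in> E" "?p \<subseteq> A" "w \<in> A" "w \<notin> v ` {..<j}" by blast
      have "\<exists>A\<in>E. {(v(j := w)) i, (v(j := w)) (Suc i mod Suc j)} \<subseteq> A" if "i < Suc j" for i
      proof -
        from that have "Suc i < j \<or> Suc i = j \<or> i = j" by linarith
        then consider "Suc i < j" | "Suc i = j" | "i = j" by blast
        then show ?thesis
        proof cases
          case 1
          then show ?thesis using v(2)[of i] by simp
        next
          case 2
          then show ?thesis using A by (intro bexI[of _ A]) auto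
        next
          case 3
          then show ?thesis using A step.hyps by (intro bexI[of _ A]) auto
        qed
      qed
      moreover have "inj_on (v(j := w)) {..<Suc j}"
        using v(1) A(4) by (auto simp: lessThan_Suc inj_on_def)
      ultimately show "\<exists>v. inj_on v {..<Suc j} \<and> (\<forall>i<Suc j. \<exists>A\<in>E. {v i, v (Suc i mod Suc j)} \<subseteq> A)"
        by blast
    qed
  qed
  then show ?thesis using assms(5) by simp
qed

section \<open>Berge copies inside a given hypergraph\<close>

definition cover :: "'a hypergraph \<Rightarrow> 'a set \<Rightarrow> 'a set set" where
  "cover H p = {A\<in>edges H. p \<subseteq> A}"

text \<open>Unlike in \<open>berge_copy\<close>, the number of hyperedges is not prescribed, so the
  property can be asked of the whole host; \<open>not_has_berge_of_free\<close> passes to a member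
  of the family.\<close>

definition has_berge :: "nat \<Rightarrow> 'a hypergraph \<Rightarrow> 'b hypergraph \<Rightarrow> bool" where
  "has_berge t F H \<longleftrightarrow> (\<exists>i h. heavy_witness t F H i h \<and>
     (\<forall>e\<in>edges F. \<forall>e'\<in>edges F. e \<noteq> e' \<longrightarrow> h e \<inter> h e' = {}))"

lemma finite_edges: "hypergraph H \<Longrightarrow> finite (edges H)"
  unfolding hypergraph_def using finite_subset by auto

lemma finite_cover: "hypergraph H \<Longrightarrow> finite (cover H p)"
  unfolding cover_def by (rule finite_subset[OF _ finite_edges]) auto

text \<open>From length 3 on an edge determines its index, so hyperedges chosen by index define a
  map on edges.\<close>

lemma cycle_edge_eq_iff:
  assumes "3 \<le> l" "i < l" "j < l"
  shows "{i, Suc i mod l} = {j, Suc j mod l} \<longleftrightarrow> i = j"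
  using assms by (auto simp: doubleton_eq_iff mod_Suc split: if_splits)

text \<open>Small sets \<open>N i\<close> are served first, large ones greedily by
  \<open>disjoint_subfamily_choice\<close>. The \<open>N i\<close> may be proper subsets of the
  covers, which allows reserving hyperedges in odd cycles and triangles.\<close>

lemma has_berge_cycleI:
  assumes H: "hypergraph H" and l: "3 \<le> l" and t: "1 \<le> t" and v: "inj_on v {..<l}"
    and N: "\<And>i. i < l \<Longrightarrow> N i \<subseteq> cover H {v i, v (Suc i mod l)} \<and> t \<le> card (N i)"
    and disj: "\<And>i j. i < l \<Longrightarrow> j < l \<Longrightarrow> i \<noteq> j \<Longrightarrow> card (N i) < T \<Longrightarrow> card (N j) < T \<Longrightarrow> N i \<inter> N j = {}"
    and T: "t * l \<le> T"
  shows "has_berge t (cycle_graph l) H"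
proof -
  have "\<exists>S. \<forall>i\<in>{..<l}. S i \<subseteq> N i \<and> card (S i) = t \<and> (\<forall>j\<in>{..<l}. i \<noteq> j \<longrightarrow> S i \<inter> S j = {})"
    using N finite_cover[OF H] disj T finite_subset
    by (intro disjoint_subfamily_choice[where T = T]) (auto, blast)
  then obtain S where S: "\<And>i. i < l \<Longrightarrow> S i \<subseteq> N i \<and> card (S i) = t"
    and Sdisj: "\<And>i j. i < l \<Longrightarrow> j < l \<Longrightarrow> i \<noteq> j \<Longrightarrow> S i \<inter> S j = {}" by auto
  define h where "h e = S (THE i. i < l \<and> e = {i, Suc i mod l})" for e
  have h: "h {i, Suc i mod l} = S i" if "i < l" for i
  proof -
    have "(THE j. j < l \<and> {i, Suc i mod l} = {j, Suc j mod l}) = i"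
      using that cycle_edge_eq_iff[OF l] by (intro the_equality) auto
    then show ?thesis by (simp add: h_def)
  qed
  have E: "edges (cycle_graph l) = {{i, Suc i mod l} | i. i < l}" by (simp add: cycle_graph_def)
  have "v i \<in> verts H" if i: "i < l" for i
  proof -
    have "N i \<noteq> {}" using N[OF i] t by auto
    then obtain A where "A \<in> N i" by auto
    then show ?thesis using N[OF i] H by (auto simp: cover_def hypergraph_def)
  qed
  then have "v ` verts (cycle_graph l) \<subseteq> verts H" by (auto simp: cycle_graph_def)
  moreover have "h e \<subseteq> edges H \<and> card (h e) = t" if e: "e \<in> edges (cycle_graph l)" for e
  proof -
    obtain i where i: "i < l" "e = {i, Suc i mod l}" using e unfolding E by auto
    then have "h e = S i" using h by simp
    then show ?thesis using S[OF i(1)] N[OF i(1)] by (auto simp: cover_def)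
  qed
  moreover have "{v x, v y} \<subseteq> A" if xy: "{x, y} \<in> edges (cycle_graph l)" and A: "A \<in> h {x, y}" for x y A
  proof -
    obtain i where i: "i < l" "{x, y} = {i, Suc i mod l}" using xy unfolding E by auto
    then have "A \<in> S i" using A h by simp
    then have "v ` {i, Suc i mod l} \<subseteq> A" using S[OF i(1)] N[OF i(1)] by (auto simp: cover_def)
    then show ?thesis unfolding i(2)[symmetric] by simp
  qed
  ultimately have "heavy_witness t (cycle_graph l) H v h"
    using v unfolding heavy_witness_def by (simp add: cycle_graph_def)
  moreover have "h e \<inter> h e' = {}"
    if e: "e \<in> edges (cycle_graph l)" "e' \<in> edges (cycle_graph l)" "e \<noteq> e'" for e e'
  proof -
    obtain i where i: "i < l" "e = {i, Suc i mod l}" using e unfolding E by auto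
    obtain j where j: "j < l" "e' = {j, Suc j mod l}" using e unfolding E by auto
    have "i \<noteq> j" using i j e(3) by auto
    then show ?thesis using i j h Sdisj by simp
  qed
  ultimately show ?thesis unfolding has_berge_def by blast
qed

text \<open>Double counting: the total weight over incidences of pairs with hyperedges is at least
  \<open>card E\<close>, and each pair contributes at most \<open>c\<close> to it.\<close>

lemma card_le_sum_of_pair_weights:
  fixes w :: "'a set \<Rightarrow> real" and c :: real
  assumes V: "finite V" and E: "E \<subseteq> Pow V"
    and w: "\<And>A. A \<in> E \<Longrightarrow> 1 \<le> (\<Sum>p | p \<subseteq> A \<and> card p = 2. w p)"
    and c: "\<And>p. p \<subseteq> V \<Longrightarrow> card p = 2 \<Longrightarrow> w p * card {A\<in>E. p \<subseteq> A} \<le> c"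
  shows "card E \<le> c * (card V choose 2)"
proof -
  let ?P = "{p. p \<subseteq> V \<and> card p = 2}"
  have finP: "finite ?P" using V by simp
  have finE: "finite E" using V E finite_subset by auto
  have "real (card E) = (\<Sum>A\<in>E. 1)" by simp
  also have "\<dots> \<le> (\<Sum>A\<in>E. \<Sum>p | p \<in> ?P \<and> p \<subseteq> A. w p)"
  proof (rule sum_mono)
    fix A assume A: "A \<in> E"
    have "{p. p \<in> ?P \<and> p \<subseteq> A} = {p. p \<subseteq> A \<and> card p = 2}" using A E by auto
    with w[OF A] show "1 \<le> (\<Sum>p | p \<in> ?P \<and> p \<subseteq> A. w p)" by simp
  qed
  also have "\<dots> = (\<Sum>p\<in>?P. \<Sum>A | A \<in> E \<and> p \<subseteq> A. w p)"
    by (rule sum.swap_restrict[OF finE finP])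
  also have "\<dots> \<le> (\<Sum>p\<in>?P. c)"
    using c by (intro sum_mono) (simp add: mult.commute)
  also have "\<dots> = c * (card V choose 2)" using n_subsets[OF V, of 2] by simp
  finally show ?thesis .
qed

text \<open>The first two alternatives are handled by weights, the other two cost at most
  \<open>T * card D\<close> hyperedges each. For the third this is immediate. In the fourth, more
  hyperedges would leave, by \<open>codegree_core\<close>, a nonempty family whose pairs all have
  codegree at least \<open>T > 2 ^ l\<close>; it contains a cycle whose edges can be served
  greedily.\<close>

lemma card_edges_le_of_exceptional_pairs:
  fixes H :: "'a hypergraph"
  assumes H: "uniform r H" and r: "3 \<le> r" and t: "2 \<le> t" and l: "3 \<le> l"
    and nb: "\<not> has_berge t (cycle_graph l) H" and T: "2 ^ l < T" "t * l \<le> T" and D: "finite D"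
    and cases: "\<And>A. A \<in> edges H \<Longrightarrow>
      (\<exists>p\<subseteq>A. card p = 2 \<and> card (cover H p) < t) \<or>
      (\<forall>p\<subseteq>A. card p = 2 \<longrightarrow> card (cover H p) < 2 * t) \<or>
      (\<exists>p\<in>D. p \<subseteq> A \<and> card (cover H p) < T) \<or>
      (\<forall>p\<subseteq>A. card p = 2 \<longrightarrow> p \<in> D)"
  shows "real (card (edges H)) \<le> (real t - 1) * (card (verts H) choose 2) + 2 * real T * card D"
proof -
  have hH: "hypergraph H" using H uniform_def by blast
  have finA: "finite A \<and> card A = r" if "A \<in> edges H" for A
    using H that r unfolding uniform_def by (metis card.infinite not_numeral_le_zero)
  define E1 where "E1 = {A\<in>edges H. (\<exists>p\<subseteq>A. card p = 2 \<and> card (cover H p) < t) \<or>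
      (\<forall>p\<subseteq>A. card p = 2 \<longrightarrow> card (cover H p) < 2 * t)}"
  define E2 where "E2 = (\<Union>p\<in>{p\<in>D. card (cover H p) < T}. cover H p)"
  define E3 where "E3 = {A\<in>edges H. \<forall>p\<subseteq>A. card p = 2 \<longrightarrow> p \<in> D}"
  have "edges H \<subseteq> E1 \<union> (E2 \<union> E3)"
  proof
    fix A assume "A \<in> edges H"
    with cases[of A] show "A \<in> E1 \<union> (E2 \<union> E3)"
      unfolding E1_def E2_def E3_def cover_def by blast
  qed
  moreover have fin: "finite E1" "finite E2" "finite E3"
    using finite_edges[OF hH] finite_cover[OF hH] D by (auto simp: E1_def E2_def E3_def)
  ultimately have "card (edges H) \<le> card (E1 \<union> (E2 \<union> E3))" by (intro card_mono) auto
  also have "\<dots> \<le> card E1 + (card E2 + card E3)"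
    by (meson card_Un_le add_left_mono order_trans)
  finally have all: "card (edges H) \<le> card E1 + (card E2 + card E3)" .
  have "card E2 \<le> (\<Sum>p\<in>{p\<in>D. card (cover H p) < T}. card (cover H p))"
    unfolding E2_def using D by (intro card_UN_le) simp
  also have "\<dots> \<le> (\<Sum>p\<in>{p\<in>D. card (cover H p) < T}. T)" by (rule sum_mono) simp
  also have "\<dots> \<le> T * card D" using card_mono[OF D, of "{p\<in>D. card (cover H p) < T}"] by simp
  finally have E2: "card E2 \<le> T * card D" .
  have E3: "card E3 \<le> T * card D"
  proof (rule ccontr)
    assume "\<not> ?thesis"
    then have "T * card D < card E3" by simp
    from codegree_core[OF D fin(3) this] obtain E' where E': "E' \<subseteq> E3" "E' \<noteq> {}"
      "\<forall>p\<in>D. (\<exists>A\<in>E'. p \<subseteq> A) \<longrightarrow> T \<le> card {A\<in>E'. p \<subseteq> A}"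
      by (elim exE conjE) (rule that)
    have sub: "E' \<subseteq> edges H" using E' E3_def by auto
    have deg: "T \<le> card {A\<in>E'. p \<subseteq> A}" if "A \<in> E'" "p \<subseteq> A" "card p = 2" for p A
    proof -
      have "p \<in> D" using that E'(1) unfolding E3_def by auto
      then show ?thesis using E'(3) that by blast
    qed
    have "\<exists>v. inj_on v {..<l} \<and> (\<forall>i<l. \<exists>A\<in>E'. {v i, v (Suc i mod l)} \<subseteq> A)"
    proof (rule cycle_of_large_codegrees)
      show "finite E'" using E' fin finite_subset by auto
      show "2 ^ l < card {A \<in> E'. p \<subseteq> A}" if "A \<in> E'" "p \<subseteq> A" "card p = 2" for p A
        using deg[OF that] T by simp
    qed (use E' sub finA r l in auto)
    then obtain v where v: "inj_on v {..<l}" "\<And>i. i < l \<Longrightarrow> \<exists>A\<in>E'. {v i, v (Suc i mod l)} \<subseteq> A"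
      by blast
    have big: "T \<le> card (cover H {v i, v (Suc i mod l)})" if i: "i < l" for i
    proof -
      from v(2)[OF i] obtain A where A: "A \<in> E'" "{v i, v (Suc i mod l)} \<subseteq> A" by auto
      have "i \<noteq> Suc i mod l" "Suc i mod l < l" using i l by (auto simp: mod_Suc)
      then have "v i \<noteq> v (Suc i mod l)" using inj_onD[OF v(1), of i "Suc i mod l"] i by auto
      then have "T \<le> card {A \<in> E'. {v i, v (Suc i mod l)} \<subseteq> A}" using deg[OF A] by simp
      also have "\<dots> \<le> card (cover H {v i, v (Suc i mod l)})"
        using sub by (intro card_mono finite_cover[OF hH]) (auto simp: cover_def)
      finally show ?thesis .
    qed
    have "t * 1 \<le> t * l" using l by (intro mult_le_mono2) simp
    then have "t \<le> T" using T(2) by linarith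
    have "has_berge t (cycle_graph l) H"
    proof (rule has_berge_cycleI[OF hH l _ v(1), where N = "\<lambda>i. cover H {v i, v (Suc i mod l)}" and T = T])
      show "1 \<le> t" using t by simp
      show "cover H {v i, v (Suc i mod l)} \<subseteq> cover H {v i, v (Suc i mod l)} \<and>
          t \<le> card (cover H {v i, v (Suc i mod l)})" if "i < l" for i
        using big[OF that] \<open>t \<le> T\<close> by simp
      show "cover H {v i, v (Suc i mod l)} \<inter> cover H {v j, v (Suc j mod l)} = {}"
        if "i < l" "card (cover H {v i, v (Suc i mod l)}) < T" for i j
        using big[OF that(1)] that(2) by simp
    qed (rule T(2))
    with nb show False by simp
  qed
  define w :: "'a set \<Rightarrow> real" where
    "w p = (if card (cover H p) < t then 1 else if card (cover H p) < 2 * t then 1 / 3 else 0)" for p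
  have w0: "0 \<le> w p" for p by (simp add: w_def)
  have "real (card E1) \<le> (real t - 1) * (card (verts H) choose 2)"
  proof (rule card_le_sum_of_pair_weights)
    show "finite (verts H)" "E1 \<subseteq> Pow (verts H)"
      using hH by (auto simp: hypergraph_def E1_def)
    show "1 \<le> (\<Sum>p | p \<subseteq> A \<and> card p = 2. w p)" if "A \<in> E1" for A
    proof -
      have A: "finite A" "card A = r" using that finA by (auto simp: E1_def)
      then have finP: "finite {p. p \<subseteq> A \<and> card p = 2}" by simp
      show ?thesis
      proof (cases "\<exists>p\<subseteq>A. card p = 2 \<and> card (cover H p) < t")
        case True
        then obtain p where p: "p \<subseteq> A" "card p = 2" "card (cover H p) < t" by blast
        then have "1 = w p" by (simp add: w_def)
        also have "\<dots> \<le> (\<Sum>p | p \<subseteq> A \<and> card p = 2. w p)"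
          using p by (intro member_le_sum finP w0) auto
        finally show ?thesis .
      next
        case False
        with that have "1 / 3 \<le> w p" if "p \<subseteq> A" "card p = 2" for p
          using that by (auto simp: E1_def w_def)
        then have "(\<Sum>p | p \<subseteq> A \<and> card p = 2. 1 / 3) \<le> (\<Sum>p | p \<subseteq> A \<and> card p = 2. w p)"
          by (intro sum_mono) auto
        \<comment> \<open>A hyperedge has at least three pairs, so weight 1/3 on each is
          enough.\<close>
        moreover have "3 choose 2 \<le> r choose 2" using r by (rule binomial_right_mono)
        moreover have "(3::nat) choose 2 = 3" by (simp add: numeral_eq_Suc)
        ultimately show ?thesis using n_subsets[OF A(1), of 2] A(2) by simp
      qed
    qed
    show "w p * card {A\<in>E1. p \<subseteq> A} \<le> real t - 1" for p
    proof -
      have "card {A\<in>E1. p \<subseteq> A} \<le> card (cover H p)"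
        by (rule card_mono[OF finite_cover[OF hH]]) (auto simp: E1_def cover_def)
      then have "w p * card {A\<in>E1. p \<subseteq> A} \<le> w p * card (cover H p)"
        using w0 by (intro mult_left_mono) auto
      \<comment> \<open>Weight 1 meets codegree at most \<open>t - 1\<close>, and weight 1/3 meets
        codegree at most \<open>2 * t - 1\<close>.\<close>
      also have "\<dots> \<le> real t - 1" using t by (auto simp: w_def)
      finally show ?thesis .
    qed
  qed
  moreover have "real (card (edges H)) \<le> real (card E1) + (real (T * card D) + real (T * card D))"
    using all E2 E3 by linarith
  ultimately show ?thesis by simp
qed

section \<open>Cycles of even length\<close>

text \<open>The bound does not depend on the number of vertices, as
  \<open>even_cycle_avoiding\<close> requires of forbidden sets.\<close>

lemma codegree_neighbourhood:
  assumes "uniform r H" "card (cover H p) < T"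
  shows "finite (\<Union>(cover H p)) \<and> card (\<Union>(cover H p)) \<le> T * r"
proof -
  have hH: "hypergraph H" using assms uniform_def by blast
  then have fin: "finite A" if "A \<in> cover H p" for A
    using that finite_subset unfolding hypergraph_def cover_def by blast
  have "card (\<Union>A\<in>cover H p. A) \<le> (\<Sum>A\<in>cover H p. card A)"
    by (rule card_UN_le[OF finite_cover[OF hH]])
  also have "\<dots> = (\<Sum>A\<in>cover H p. r)"
    using assms(1) by (intro sum.cong) (auto simp: uniform_def cover_def)
  also have "\<dots> \<le> T * r" using assms(2) by simp
  finally show ?thesis using fin finite_cover[OF hH] by auto
qed

definition heavy_pairs :: "'a hypergraph \<Rightarrow> nat \<Rightarrow> 'a set set" where
  "heavy_pairs H t = {p. p \<subseteq> verts H \<and> card p = 2 \<and> t \<le> card (cover H p)}"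

text \<open>If a vertex of another pair \<open>q\<close> avoids \<open>scatter H T p\<close> and the codegree of \<open>p\<close> is below \<open>T\<close>, then
  no hyperedge lies over both \<open>p\<close> and \<open>q\<close>. Pairs of codegree at least \<open>T\<close> have hyperedges to spare.\<close>

definition scatter :: "'a hypergraph \<Rightarrow> nat \<Rightarrow> 'a set \<Rightarrow> 'a set" where
  "scatter H T p = (if card (cover H p) < T then \<Union>(cover H p) else {})"

lemma scatter_disjoint:
  assumes "card (cover H p) < T" "x \<in> q" "x \<notin> scatter H T p"
  shows "cover H p \<inter> cover H q = {}"
  using assms by (auto simp: scatter_def cover_def)

lemma finite_heavy_pairs: "hypergraph H \<Longrightarrow> finite (heavy_pairs H t)"
  unfolding heavy_pairs_def hypergraph_def by simp

text \<open>Distinct edges share at most one vertex. The vertex left over is the one whose avoidance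
  of \<open>scatter\<close> separates the hyperedges of the two edges.\<close>

lemma cycle_edge_not_subset:
  assumes "3 \<le> l" "i < l" "j < l" "i \<noteq> j"
  shows "\<exists>m<l. m \<in> {j, Suc j mod l} \<and> m \<noteq> i \<and> m \<noteq> Suc i mod l"
proof (rule ccontr)
  assume "\<not> ?thesis"
  moreover have "Suc j mod l < l" using assms by simp
  ultimately have "j \<in> {i, Suc i mod l}" "Suc j mod l \<in> {i, Suc i mod l}" using assms(3) by blast+
  then show False using assms by (auto simp: mod_Suc split: if_splits)
qed

text \<open>All heavy pairs count as exceptional. If they were dense,
  \<open>even_cycle_avoiding\<close> with \<open>scatter\<close> as forbidden set would yield a
  cycle whose edges of small codegree have disjoint covers, hence a Berge cycle.\<close>

lemma berge_even_cycle_bound: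
  fixes \<epsilon> :: real
  assumes r: "3 \<le> r" and t: "2 \<le> t" and l: "even l" "4 \<le> l" and "\<epsilon> > 0"
  shows "\<exists>n0. \<forall>H :: 'a hypergraph. uniform r H \<longrightarrow> n0 \<le> card (verts H) \<longrightarrow>
    \<not> has_berge t (cycle_graph l) H \<longrightarrow>
    real (card (edges H)) \<le> (real t - 1) * (card (verts H) choose 2) + \<epsilon> * (real (card (verts H)))\<^sup>2"
proof -
  \<comment> \<open>Above \<open>2 ^ l\<close> for growing cycles in a family of large codegrees,
    and at least \<open>t * l\<close> for the greedy choice of hyperedges.\<close>
  define T where "T = 2 ^ l + t * l + 1"
  have T: "2 ^ l < T" "t * l \<le> T" "T > 0" by (auto simp: T_def)
  \<comment> \<open>Cancels the factor \<open>2 * T\<close> with which exceptional pairs enter the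
    bound.\<close>
  define \<delta> where "\<delta> = \<epsilon> / (2 * real T)"
  have "\<delta> > 0" using \<open>\<epsilon> > 0\<close> T by (simp add: \<delta>_def)
  from even_cycle_avoiding[OF this l, of "T * r", where 'a = 'a] obtain n0 where n0:
    "\<forall>V :: 'a set. \<forall>D. \<forall>\<phi> :: 'a set \<Rightarrow> 'a set. finite V \<longrightarrow> n0 \<le> card V \<longrightarrow> (\<forall>e\<in>D. e \<subseteq> V \<and> card e = 2) \<longrightarrow>
     \<delta> * (real (card V))\<^sup>2 < card D \<longrightarrow> (\<forall>e\<in>D. finite (\<phi> e) \<and> card (\<phi> e) \<le> T * r) \<longrightarrow>
     (\<exists>v. inj_on v {..<l} \<and> (\<forall>i<l. {v i, v (Suc i mod l)} \<in> D) \<and>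
        (\<forall>i<l. \<forall>m<l. m \<noteq> i \<longrightarrow> m \<noteq> Suc i mod l \<longrightarrow> v m \<notin> \<phi> {v i, v (Suc i mod l)}))"
    by (elim exE) (rule that)
  show ?thesis
  proof (intro exI[of _ n0] allI impI)
    fix H :: "'a hypergraph"
    assume H: "uniform r H" and n: "n0 \<le> card (verts H)" and nb: "\<not> has_berge t (cycle_graph l) H"
    have hH: "hypergraph H" using H uniform_def by blast
    have l3: "3 \<le> l" using l by simp
    let ?D = "heavy_pairs H t"
    have small: "card ?D \<le> \<delta> * (real (card (verts H)))\<^sup>2"
    proof (rule ccontr)
      assume "\<not> ?thesis"
      then have dense: "\<delta> * (real (card (verts H)))\<^sup>2 < card ?D" by simp
      have sc: "\<forall>e\<in>?D. finite (scatter H T e) \<and> card (scatter H T e) \<le> T * r"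
        using codegree_neighbourhood[OF H] by (auto simp: scatter_def)
      have "finite (verts H)" "\<forall>e\<in>?D. e \<subseteq> verts H \<and> card e = 2"
        using hH by (auto simp: heavy_pairs_def hypergraph_def)
      with n0 n dense sc have "\<exists>v. inj_on v {..<l} \<and> (\<forall>i<l. {v i, v (Suc i mod l)} \<in> ?D) \<and>
        (\<forall>i<l. \<forall>m<l. m \<noteq> i \<longrightarrow> m \<noteq> Suc i mod l \<longrightarrow> v m \<notin> scatter H T {v i, v (Suc i mod l)})"
        by (elim allE[of _ "verts H"] allE[of _ ?D] allE[of _ "scatter H T"] impE) assumption+
      then obtain v where v: "inj_on v {..<l}"
        "\<And>i. i < l \<Longrightarrow> {v i, v (Suc i mod l)} \<in> ?D"
        "\<And>i m. i < l \<Longrightarrow> m < l \<Longrightarrow> m \<noteq> i \<Longrightarrow> m \<noteq> Suc i mod l \<Longrightarrow> v m \<notin> scatter H T {v i, v (Suc i mod l)}"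
        by blast
      have "has_berge t (cycle_graph l) H"
      proof (rule has_berge_cycleI[OF hH l3 _ v(1), where N = "\<lambda>i. cover H {v i, v (Suc i mod l)}" and T = T])
        fix i j assume ij: "i < l" "j < l" "i \<noteq> j" "card (cover H {v i, v (Suc i mod l)}) < T"
        obtain m where m: "m < l" "m \<in> {j, Suc j mod l}" "m \<noteq> i" "m \<noteq> Suc i mod l"
          using cycle_edge_not_subset[OF l3 ij(1-3)] by blast
        show "cover H {v i, v (Suc i mod l)} \<inter> cover H {v j, v (Suc j mod l)} = {}"
          using m v(3)[OF ij(1) m(1,3,4)] by (intro scatter_disjoint[OF ij(4), of "v m"]) auto
      qed (use t T v(2) in \<open>auto simp: heavy_pairs_def\<close>)
      with nb show False by simp
    qed
    have "real (card (edges H)) \<le> (real t - 1) * (card (verts H) choose 2) + 2 * real T * card ?D"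
    proof (rule card_edges_le_of_exceptional_pairs[OF H r t l3 nb T(1,2) finite_heavy_pairs[OF hH]])
      fix A assume A: "A \<in> edges H"
      then have "A \<subseteq> verts H" using hH by (auto simp: hypergraph_def)
      \<comment> \<open>A hyperedge without a pair of codegree below \<open>t\<close> has only heavy
        pairs, so the first or the last alternative always applies.\<close>
      then show "(\<exists>p\<subseteq>A. card p = 2 \<and> card (cover H p) < t) \<or>
        (\<forall>p\<subseteq>A. card p = 2 \<longrightarrow> card (cover H p) < 2 * t) \<or>
        (\<exists>p\<in>?D. p \<subseteq> A \<and> card (cover H p) < T) \<or>
        (\<forall>p\<subseteq>A. card p = 2 \<longrightarrow> p \<in> ?D)"
        unfolding heavy_pairs_def by (metis (mono_tags, lifting) mem_Collect_eq not_less subset_trans)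
    qed
    also have "2 * real T * card ?D \<le> 2 * real T * (\<delta> * (real (card (verts H)))\<^sup>2)"
      using small by (intro mult_left_mono) auto
    also have "\<dots> = \<epsilon> * (real (card (verts H)))\<^sup>2" using T by (simp add: \<delta>_def)
    finally show "real (card (edges H)) \<le> (real t - 1) * (card (verts H) choose 2) + \<epsilon> * (real (card (verts H)))\<^sup>2"
      by simp
  qed
qed

section \<open>Odd cycles\<close>

text \<open>Hall's condition for two sets: \<open>Q1\<close> takes elements outside
  \<open>N2\<close> first and only the shortfall from the intersection.\<close>

lemma disjoint_pair_choice:
  assumes fin: "finite N1" "finite N2" and t: "t \<le> card N1" "t \<le> card N2" "2 * t \<le> card (N1 \<union> N2)"
  shows "\<exists>Q1 Q2. Q1 \<subseteq> N1 \<and> Q2 \<subseteq> N2 \<and> Q1 \<inter> Q2 = {} \<and> card Q1 = t \<and> card Q2 = t"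
proof (cases "t \<le> card (N1 - N2)")
  case True
  then obtain Q1 where "Q1 \<subseteq> N1 - N2" "card Q1 = t" by (meson obtain_subset_with_card_n)
  moreover obtain Q2 where "Q2 \<subseteq> N2" "card Q2 = t" using t by (meson obtain_subset_with_card_n)
  ultimately show ?thesis by (intro exI[of _ Q1] exI[of _ Q2]) auto
next
  case False
  have c1: "card N1 = card (N1 - N2) + card (N1 \<inter> N2)"
    using fin card_Un_disjoint[of "N1 - N2" "N1 \<inter> N2"] by (simp add: Un_Diff_Int Int_Diff disjoint_iff)
  then have "t - card (N1 - N2) \<le> card (N1 \<inter> N2)" using t by simp
  then obtain B where B: "B \<subseteq> N1 \<inter> N2" "card B = t - card (N1 - N2)" by (meson obtain_subset_with_card_n)
  have finB: "finite B" using B fin finite_subset by blast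
  have "card (N1 \<union> N2) = card (N1 - N2) + card N2"
    using card_Un_disjoint[of "N1 - N2" N2] fin by (simp add: Diff_disjoint Int_commute)
  moreover have "card (N2 - B) = card N2 - card B" using B finB by (intro card_Diff_subset) auto
  ultimately have "t \<le> card (N2 - B)" using B t False by simp
  then obtain Q2 where Q2: "Q2 \<subseteq> N2 - B" "card Q2 = t" by (meson obtain_subset_with_card_n)
  have "card ((N1 - N2) \<union> B) = t"
    using card_Un_disjoint[of "N1 - N2" B] B fin finB False by auto
  then show ?thesis using B Q2 by (intro exI[of _ "(N1 - N2) \<union> B"] exI[of _ Q2]) auto
qed

text \<open>The set \<open>W\<close> will be covered by the hyperedges reserved for the two edges that close the path to
  an odd cycle.\<close>

definition spread_path ::
  "'a hypergraph \<Rightarrow> nat \<Rightarrow> nat \<Rightarrow> 'a set \<Rightarrow> nat \<Rightarrow> (nat \<Rightarrow> 'a) \<Rightarrow> bool" where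
  "spread_path H t T W L v \<longleftrightarrow> inj_on v {..<L} \<and>
     (\<forall>i. 0 < i \<longrightarrow> Suc i < L \<longrightarrow> v i \<notin> W) \<and>
     (\<forall>i. Suc i < L \<longrightarrow> {v i, v (Suc i)} \<in> heavy_pairs H t) \<and>
     (\<forall>i m. Suc i < L \<longrightarrow> m < L \<longrightarrow> m \<noteq> i \<longrightarrow> m \<noteq> Suc i \<longrightarrow> v m \<notin> scatter H T {v i, v (Suc i)})"

text \<open>The vertex \<open>z\<close> closes the path. Every path edge has an inner vertex of the
  path as an end; this vertex lies in no hyperedge of \<open>Q1\<close> or \<open>Q2\<close>, so the
  reserved hyperedges do not interfere with those of the path.\<close>

lemma has_berge_odd_cycleI:
  assumes hH: "hypergraph H" and L: "4 \<le> L" and t: "1 \<le> t" and T: "t * Suc L \<le> T"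
    and Q1: "Q1 \<subseteq> cover H {z, v 0}" "card Q1 = t" and Q2: "Q2 \<subseteq> cover H {v (L - 1), z}" "card Q2 = t"
    and Q: "Q1 \<inter> Q2 = {}" and z: "z \<noteq> v 0" "z \<noteq> v (L - 1)"
    and v: "spread_path H t T (\<Union>(Q1 \<union> Q2)) L v"
  shows "has_berge t (cycle_graph (Suc L)) H"
proof -
  let ?W = "\<Union>(Q1 \<union> Q2)"
  define u where "u = v(L := z)"
  \<comment> \<open>Index \<open>L - 1\<close> is the edge from the end of the path to
    \<open>z\<close>, index \<open>L\<close> the edge from \<open>z\<close> back to
    \<open>v 0\<close>.\<close>
  define N where "N i = (if Suc i < L then cover H {v i, v (Suc i)} else if Suc i = L then Q2 else Q1)" for i
  have inj: "inj_on v {..<L}" and inner: "\<And>i. 0 < i \<Longrightarrow> Suc i < L \<Longrightarrow> v i \<notin> ?W"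
    and edge: "\<And>i. Suc i < L \<Longrightarrow> {v i, v (Suc i)} \<in> heavy_pairs H t"
    and sc: "\<And>i m. Suc i < L \<Longrightarrow> m < L \<Longrightarrow> m \<noteq> i \<Longrightarrow> m \<noteq> Suc i \<Longrightarrow> v m \<notin> scatter H T {v i, v (Suc i)}"
    using v unfolding spread_path_def by blast+
  have "Q1 \<noteq> {}" using Q1 t by auto
  \<comment> \<open>Hence \<open>z\<close> is no inner vertex of the path, and the hypotheses
    exclude the two ends.\<close>
  then have zW: "z \<in> ?W" using Q1 by (auto simp: cover_def)
  have zv: "z \<notin> v ` {..<L}"
  proof
    assume "z \<in> v ` {..<L}"
    then obtain i where i: "i < L" "z = v i" by auto
    then have "i \<noteq> 0" "i \<noteq> L - 1" using z by metis+
    then show False using inner[of i] i zW by simp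
  qed
  have meet: "cover H {v i, v (Suc i)} \<inter> (Q1 \<union> Q2) = {}" if "Suc i < L" for i
  proof -
    \<comment> \<open>The vertex \<open>v 0\<close> may lie in \<open>?W\<close>, so the first edge
      is represented by its other end.\<close>
    obtain j where "j \<in> {i, Suc i}" "0 < j" "Suc j < L"
    proof (cases "i = 0")
      case True
      then show ?thesis using L by (intro that[of 1]) auto
    next
      case False
      then show ?thesis using \<open>Suc i < L\<close> by (intro that[of i]) auto
    qed
    then have "v j \<in> {v i, v (Suc i)}" "v j \<notin> ?W" using inner by auto
    then show ?thesis by (auto simp: cover_def)
  qed
  show ?thesis
  proof (rule has_berge_cycleI[OF hH _ t, where v = u and N = N and T = T])
    show "3 \<le> Suc L" using L by simp
    show "inj_on u {..<Suc L}"
      using inj zv by (auto simp: u_def lessThan_Suc inj_on_def)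
    show "N i \<subseteq> cover H {u i, u (Suc i mod Suc L)} \<and> t \<le> card (N i)" if "i < Suc L" for i
    proof -
      from that have "Suc i < L \<or> Suc i = L \<or> i = L" by linarith
      then consider "Suc i < L" | "Suc i = L" | "i = L" by blast
      then show ?thesis
      proof cases
        case 1
        then show ?thesis using edge[OF 1] by (simp add: N_def u_def heavy_pairs_def)
      next
        case 2
        then have "i = L - 1" "i \<noteq> L" by simp_all
        then show ?thesis using Q2 L by (simp add: N_def u_def)
      next
        case 3
        then show ?thesis using Q1 L by (simp add: N_def u_def)
      qed
    qed
    show "t * Suc L \<le> T" by (rule T)
    have inner_disj: "N i \<inter> N j = {}" if "Suc i < L" "j < Suc L" "i \<noteq> j" "card (N i) < T" for i j
    proof (cases "Suc j < L")
      case True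
      \<comment> \<open>An end of edge \<open>j\<close> off edge \<open>i\<close>: consecutive edges
        share \<open>Suc i\<close>, so the far end is taken.\<close>
      define m where "m = (if j = Suc i then Suc j else j)"
      have m: "m < L" "m \<noteq> i" "m \<noteq> Suc i" "m \<in> {j, Suc j}" using True that by (auto simp: m_def)
      have "cover H {v i, v (Suc i)} \<inter> cover H {v j, v (Suc j)} = {}"
        using that m(4) by (intro scatter_disjoint[OF _ _ sc[OF that(1) m(1-3)]]) (auto simp: N_def)
      then show ?thesis using True that by (simp add: N_def)
    next
      case False
      then show ?thesis using meet[OF that(1)] that by (auto simp: N_def)
    qed
    show "N i \<inter> N j = {}" if ij: "i < Suc L" "j < Suc L" "i \<noteq> j" "card (N i) < T" "card (N j) < T" for i j
    proof -
      consider "Suc i < L" | "Suc j < L" | "\<not> Suc i < L" "\<not> Suc j < L" by blast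
      then show ?thesis
      proof cases
        case 1
        then show ?thesis using inner_disj ij by simp
      next
        case 2
        then show ?thesis using inner_disj[of j i] ij by (simp add: Int_commute)
      next
        case 3
        then have "(Suc i = L \<and> j = L) \<or> (i = L \<and> Suc j = L)" using ij by linarith
        then show ?thesis using Q by (auto simp: N_def)
      qed
    qed
  qed
qed

text \<open>A heavy pair is exceptional if some bounded set \<open>W\<close> blocks all spread paths
  between its ends. Densely many such pairs would contain an even cycle avoiding the blocking set of
  each of its edges; without one edge it is a path that should have been blocked. For the other
  pairs, a third vertex either closes a Berge cycle or has few hyperedges towards the pair.\<close>

lemma berge_odd_cycle_bound:
  fixes \<epsilon> :: real
  assumes r: "3 \<le> r" and t: "2 \<le> t" and l: "odd l" "5 \<le> l" and "\<epsilon> > 0"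
  shows "\<exists>n0. \<forall>H :: 'a hypergraph. uniform r H \<longrightarrow> n0 \<le> card (verts H) \<longrightarrow>
    \<not> has_berge t (cycle_graph l) H \<longrightarrow>
    real (card (edges H)) \<le> (real t - 1) * (card (verts H) choose 2) + \<epsilon> * (real (card (verts H)))\<^sup>2"
proof -
  define T where "T = 2 ^ l + t * l + 1"
  have T: "2 ^ l < T" "t * l \<le> T" "T > 0" by (auto simp: T_def)
  have "t * 2 \<le> t * l" using l by (intro mult_le_mono2) simp
  then have tT: "2 * t \<le> T" using T by linarith
  define \<delta> where "\<delta> = \<epsilon> / (2 * real T)"
  have "\<delta> > 0" using \<open>\<epsilon> > 0\<close> T by (simp add: \<delta>_def)
  define L where "L = l - 1"
  have L: "even L" "4 \<le> L" "l = Suc L" using l by (auto simp: L_def)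
  \<comment> \<open>At most \<open>2 * t\<close> hyperedges of size \<open>r\<close> form a blocking
    set, and fewer than \<open>T\<close> of them a scatter set.\<close>
  define c where "c = 2 * t * r + T * r"
  from even_cycle_avoiding[OF \<open>\<delta> > 0\<close> L(1,2), of c, where 'a = 'a] obtain n0 where n0:
    "\<forall>V :: 'a set. \<forall>D. \<forall>\<phi> :: 'a set \<Rightarrow> 'a set. finite V \<longrightarrow> n0 \<le> card V \<longrightarrow> (\<forall>e\<in>D. e \<subseteq> V \<and> card e = 2) \<longrightarrow>
     \<delta> * (real (card V))\<^sup>2 < card D \<longrightarrow> (\<forall>e\<in>D. finite (\<phi> e) \<and> card (\<phi> e) \<le> c) \<longrightarrow>
     (\<exists>v. inj_on v {..<L} \<and> (\<forall>i<L. {v i, v (Suc i mod L)} \<in> D) \<and>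
        (\<forall>i<L. \<forall>m<L. m \<noteq> i \<longrightarrow> m \<noteq> Suc i mod L \<longrightarrow> v m \<notin> \<phi> {v i, v (Suc i mod L)}))"
    by (elim exE) (rule that)
  show ?thesis
  proof (intro exI[of _ n0] allI impI)
    fix H :: "'a hypergraph"
    assume H: "uniform r H" and n: "n0 \<le> card (verts H)" and nb: "\<not> has_berge t (cycle_graph l) H"
    have hH: "hypergraph H" using H uniform_def by blast
    have l3: "3 \<le> l" using l by simp
    \<comment> \<open>The hyperedges reserved for the closing edges depend on the third vertex, so a
      single bad \<open>W\<close> already makes a pair exceptional.\<close>
    define blocked where "blocked p W \<longleftrightarrow> finite W \<and> card W \<le> 2 * t * r \<and>
      (\<forall>v. p = {v 0, v (L - 1)} \<longrightarrow> \<not> spread_path H t T W L v)" for p W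
    define D where "D = {p\<in>heavy_pairs H t. \<exists>W. blocked p W}"
    have "\<forall>p\<in>D. \<exists>W. blocked p W" by (simp add: D_def)
    then obtain W where W: "\<And>p. p \<in> D \<Longrightarrow> blocked p (W p)" by metis
    have D: "finite D" "D \<subseteq> heavy_pairs H t" using finite_heavy_pairs[OF hH] by (auto simp: D_def)
    have small: "card D \<le> \<delta> * (real (card (verts H)))\<^sup>2"
    proof (rule ccontr)
      let ?\<phi> = "\<lambda>e. W e \<union> scatter H T e"
      assume "\<not> ?thesis"
      then have dense: "\<delta> * (real (card (verts H)))\<^sup>2 < card D" by simp
      have sc: "\<forall>e\<in>D. finite (?\<phi> e) \<and> card (?\<phi> e) \<le> c"
      proof
        fix e assume "e \<in> D"
        then have "finite (W e)" "card (W e) \<le> 2 * t * r" using W by (auto simp: blocked_def)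
        moreover have "finite (scatter H T e)" "card (scatter H T e) \<le> T * r"
          using codegree_neighbourhood[OF H] by (auto simp: scatter_def)
        ultimately show "finite (?\<phi> e) \<and> card (?\<phi> e) \<le> c"
          using card_Un_le[of "W e" "scatter H T e"] by (simp add: c_def)
      qed
      have "finite (verts H)" "\<forall>e\<in>D. e \<subseteq> verts H \<and> card e = 2"
        using hH D by (auto simp: heavy_pairs_def hypergraph_def)
      with n0 n dense sc have "\<exists>v. inj_on v {..<L} \<and> (\<forall>i<L. {v i, v (Suc i mod L)} \<in> D) \<and>
        (\<forall>i<L. \<forall>m<L. m \<noteq> i \<longrightarrow> m \<noteq> Suc i mod L \<longrightarrow> v m \<notin> ?\<phi> {v i, v (Suc i mod L)})"
        by (elim allE[of _ "verts H"] allE[of _ D] allE[of _ ?\<phi>] impE) assumption+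
      then obtain v where v: "inj_on v {..<L}"
        "\<And>i. i < L \<Longrightarrow> {v i, v (Suc i mod L)} \<in> D"
        "\<And>i m. i < L \<Longrightarrow> m < L \<Longrightarrow> m \<noteq> i \<Longrightarrow> m \<noteq> Suc i mod L \<Longrightarrow> v m \<notin> ?\<phi> {v i, v (Suc i mod L)}"
        by blast
      \<comment> \<open>Deleting the closing edge of the cycle leaves a path between its ends, whose
        inner vertices avoid the set \<open>W ?p\<close> chosen for this very edge.\<close>
      let ?p = "{v 0, v (L - 1)}"
      have last: "Suc (L - 1) mod L = 0" "L - 1 < L" using L by auto
      have p: "?p \<in> D" using v(2)[of "L - 1"] last by (simp add: insert_commute)
      have "spread_path H t T (W ?p) L v"
        unfolding spread_path_def
      proof (intro conjI allI impI v(1))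
        fix i assume i: "0 < i" "Suc i < L"
        then show "v i \<notin> W ?p"
          using v(3)[OF last(2), of i] last by (simp add: insert_commute)
      next
        fix i assume "Suc i < L"
        then show "{v i, v (Suc i)} \<in> heavy_pairs H t" using v(2)[of i] D(2) by auto
      next
        fix i m assume "Suc i < L" "m < L" "m \<noteq> i" "m \<noteq> Suc i"
        then show "v m \<notin> scatter H T {v i, v (Suc i)}" using v(3)[of i m] by simp
      qed
      with W[OF p] show False by (auto simp: blocked_def)
    qed
    \<comment> \<open>Otherwise \<open>t\<close> hyperedges over \<open>{x, z}\<close> and
      \<open>t\<close> over \<open>{y, z}\<close> can be reserved disjointly. Their union does not
      block \<open>{x, y}\<close>, so a spread path and \<open>z\<close> form a Berge cycle.\<close>
    have low: "card (cover H {x, z} \<union> cover H {y, z}) < 2 * t"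
      if xy: "{x, y} \<in> heavy_pairs H t" "{x, y} \<notin> D" and xz: "{x, z} \<in> heavy_pairs H t" and yz: "{y, z} \<in> heavy_pairs H t"
      for x y z
    proof (rule ccontr)
      assume big: "\<not> ?thesis"
      have "z \<noteq> x" "z \<noteq> y" using xz yz by (auto simp: heavy_pairs_def)
      obtain Q1 Q2 where Q: "Q1 \<subseteq> cover H {x, z}" "Q2 \<subseteq> cover H {y, z}" "Q1 \<inter> Q2 = {}" "card Q1 = t" "card Q2 = t"
        using disjoint_pair_choice[OF finite_cover[OF hH, of "{x, z}"] finite_cover[OF hH, of "{y, z}"], of t] big xz yz
        by (auto simp: heavy_pairs_def)
      have QE: "Q1 \<union> Q2 \<subseteq> edges H" using Q by (auto simp: cover_def)
      then have finQ: "finite (Q1 \<union> Q2)" using finite_edges[OF hH] finite_subset by blast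
      have "card (\<Union>A\<in>Q1 \<union> Q2. A) \<le> (\<Sum>A\<in>Q1 \<union> Q2. card A)" by (rule card_UN_le[OF finQ])
      also have "\<dots> = (\<Sum>A\<in>Q1 \<union> Q2. r)"
        using H QE by (intro sum.cong) (auto simp: uniform_def)
      also have "\<dots> \<le> 2 * t * r" using card_Un_le[of Q1 Q2] Q by simp
      finally have cW: "card (\<Union>(Q1 \<union> Q2)) \<le> 2 * t * r" by simp
      have "\<Union>(edges H) \<subseteq> verts H" "finite (verts H)" using hH by (auto simp: hypergraph_def)
      with Union_mono[OF QE] have fW: "finite (\<Union>(Q1 \<union> Q2))" by (meson finite_subset subset_trans)
      have "\<not> blocked {x, y} (\<Union>(Q1 \<union> Q2))" using xy by (auto simp: D_def)
      then obtain v where v: "{x, y} = {v 0, v (L - 1)}" "spread_path H t T (\<Union>(Q1 \<union> Q2)) L v"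
        using fW cW unfolding blocked_def by blast
      have TL: "t * Suc L \<le> T" using T L by simp
      have t1: "1 \<le> t" using t by simp
      from v(1) consider "x = v 0" "y = v (L - 1)" | "y = v 0" "x = v (L - 1)"
        by (auto simp: doubleton_eq_iff)
      then have "has_berge t (cycle_graph (Suc L)) H"
      proof cases
        case 1
        show ?thesis
          using Q v(2) 1 \<open>z \<noteq> x\<close> \<open>z \<noteq> y\<close>
          by (intro has_berge_odd_cycleI[OF hH L(2) t1 TL, of Q1 z v Q2]) (simp_all add: insert_commute)
      next
        case 2
        show ?thesis
          using Q v(2) 2 \<open>z \<noteq> x\<close> \<open>z \<noteq> y\<close>
          by (intro has_berge_odd_cycleI[OF hH L(2) t1 TL, of Q2 z v Q1]) (simp_all add: insert_commute Int_commute Un_commute)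
      qed
      with nb L(3) show False by simp
    qed
    have "real (card (edges H)) \<le> (real t - 1) * (card (verts H) choose 2) + 2 * real T * card D"
    proof (rule card_edges_le_of_exceptional_pairs[OF H r t l3 nb T(1,2) D(1)])
      fix A assume A: "A \<in> edges H"
      have AV: "A \<subseteq> verts H" using hH A by (auto simp: hypergraph_def)
      show "(\<exists>p\<subseteq>A. card p = 2 \<and> card (cover H p) < t) \<or>
        (\<forall>p\<subseteq>A. card p = 2 \<longrightarrow> card (cover H p) < 2 * t) \<or>
        (\<exists>p\<in>D. p \<subseteq> A \<and> card (cover H p) < T) \<or>
        (\<forall>p\<subseteq>A. card p = 2 \<longrightarrow> p \<in> D)"
      proof (rule ccontr)
        assume *: "\<not> ?thesis"
        have pr: "{a, b} \<in> heavy_pairs H t" if "a \<in> A" "b \<in> A" "a \<noteq> b" for a b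
        proof -
          have "{a, b} \<subseteq> A" "card {a, b} = 2" using that by auto
          then have "\<not> card (cover H {a, b}) < t" using * by blast
          then show ?thesis using that AV by (auto simp: heavy_pairs_def)
        qed
        from * obtain p0 where "p0 \<subseteq> A" "card p0 = 2" "p0 \<notin> D" by blast
        then obtain x y where xy: "x \<in> A" "y \<in> A" "x \<noteq> y" "{x, y} \<notin> D"
          by (auto simp: card_2_iff)
        \<comment> \<open>Lying outside \<open>D\<close> spreads: \<open>{a, c}\<close> has codegree
          below \<open>2 * t \<le> T\<close>, so the failure of the third alternative keeps it out
          of \<open>D\<close>.\<close>
        have step: "card (cover H {a, c}) < 2 * t \<and> card (cover H {b, c}) < 2 * t \<and> {a, c} \<notin> D"
          if "a \<in> A" "b \<in> A" "c \<in> A" "a \<noteq> b" "a \<noteq> c" "b \<noteq> c" "{a, b} \<notin> D" for a b c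
        proof -
          have "card (cover H {a, c} \<union> cover H {b, c}) < 2 * t" using low pr that by blast
          moreover have "card (cover H {a, c}) \<le> card (cover H {a, c} \<union> cover H {b, c})"
            "card (cover H {b, c}) \<le> card (cover H {a, c} \<union> cover H {b, c})"
            using finite_cover[OF hH] by (auto intro!: card_mono)
          ultimately have less: "card (cover H {a, c}) < 2 * t" "card (cover H {b, c}) < 2 * t" by linarith+
          have "{a, c} \<subseteq> A" "card (cover H {a, c}) < T" using that less tT by auto
          then have "{a, c} \<notin> D" using * by blast
          with less show ?thesis by blast
        qed
        have "finite A" "card A = r" using H A AV hH finite_subset by (auto simp: uniform_def hypergraph_def)
        then have "\<not> A \<subseteq> {x, y}" using r card_mono[of "{x, y}" A] xy by auto
        then obtain z where z: "z \<in> A" "z \<noteq> x" "z \<noteq> y" by auto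
        have xz: "{x, z} \<notin> D" using step[of x y z] xy z by blast
        \<comment> \<open>All pairs at \<open>x\<close> are reached from \<open>{x, y}\<close>; the
          pair \<open>{x, y}\<close> itself needs the detour through \<open>{x, z}\<close>.\<close>
        have star: "card (cover H {x, c}) < 2 * t \<and> {x, c} \<notin> D" if "c \<in> A" "c \<noteq> x" for c
        proof (cases "c = y")
          case True
          then show ?thesis using step[of x z y] xy xz z by auto
        next
          case False
          then show ?thesis using step[of x y c] xy that by auto
        qed
        have "card (cover H p) < 2 * t" if p: "p \<subseteq> A" "card p = 2" for p
        proof -
          obtain a b where ab: "p = {a, b}" "a \<noteq> b" using p(2) by (auto simp: card_2_iff)
          have AB: "a \<in> A" "b \<in> A" using ab p by auto
          consider "a = x" | "b = x" | "a \<noteq> x" "b \<noteq> x" by blast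
          then show ?thesis
          proof cases
            case 1
            then show ?thesis using star[of b] ab AB by auto
          next
            case 2
            then show ?thesis using star[of a] ab AB by (auto simp: insert_commute)
          next
            case 3
            then show ?thesis using step[of x a b] star[of a] ab AB xy by auto
          qed
        qed
        with * show False by blast
      qed
    qed
    also have "2 * real T * card D \<le> 2 * real T * (\<delta> * (real (card (verts H)))\<^sup>2)"
      using small by (intro mult_left_mono) auto
    also have "\<dots> = \<epsilon> * (real (card (verts H)))\<^sup>2" using T by (simp add: \<delta>_def)
    finally show "real (card (edges H)) \<le> (real t - 1) * (card (verts H) choose 2) + \<epsilon> * (real (card (verts H)))\<^sup>2"
      by simp
  qed
qed

section \<open>The triangle\<close>

text \<open>If all pairs in a hyperedge have codegree at least 2, then at least two of them have codegree
  exactly 2; these get weight 1/2.\<close>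

lemma berge_triangle_bound:
  fixes H :: "'a hypergraph"
  assumes H: "uniform 3 H" and nb: "\<not> has_berge 2 (cycle_graph 3) H"
  shows "card (edges H) \<le> card (verts H) choose 2"
proof -
  have hH: "hypergraph H" using H uniform_def by blast
  define w :: "'a set \<Rightarrow> real" where
    "w p = (if card (cover H p) < 2 then 1 else if card (cover H p) = 2 then 1 / 2 else 0)" for p
  have w0: "0 \<le> w p" for p by (simp add: w_def)
  \<comment> \<open>The hyperedge \<open>A\<close> is left to \<open>{b, c}\<close>; the two pairs
    of codegree at least 3 can spare it.\<close>
  have rich: False
    if A: "A = {a, b, c}" "A \<in> edges H" and ne: "a \<noteq> b" "a \<noteq> c" "b \<noteq> c"
      and deg: "3 \<le> card (cover H {a, b})" "3 \<le> card (cover H {a, c})" "2 \<le> card (cover H {b, c})"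
    for A a b c
  proof -
    define v where "v i = (if i = 0 then b else if i = 1 then a else c)" for i :: nat
    define N where "N i = (if i = 0 then cover H {a, b} - {A} else if i = 1 then cover H {a, c} - {A}
      else cover H {b, c})" for i :: nat
    \<comment> \<open>Two different pairs of \<open>{a, b, c}\<close> span all three vertices, so by
      3-uniformity only \<open>A\<close> can lie over both.\<close>
    have only: "B = A" if "B \<in> edges H" "{a, b, c} \<subseteq> B" for B
    proof -
      have "card B = 3" "card {a, b, c} = 3" using H that ne by (auto simp: uniform_def)
      moreover have "finite B" using \<open>card B = 3\<close> by (metis card.infinite zero_neq_numeral)
      ultimately show ?thesis using that A card_subset_eq[of B "{a, b, c}"] by auto
    qed
    have N2: "2 \<le> card (N i)" if "i < 3" for i
      using deg card_Diff_singleton_if[of "cover H {a, b}" A] card_Diff_singleton_if[of "cover H {a, c}" A]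
        that by (auto simp: N_def split: if_splits)
    have sub: "N i \<subseteq> cover H {v i, v (Suc i mod 3)}" if "i < 3" for i
    proof -
      have "i = 0 \<or> i = 1 \<or> i = 2" using that by linarith
      then show ?thesis by (elim disjE) (simp_all add: N_def v_def insert_commute Diff_subset)
    qed
    have disj: "N i \<inter> N j = {}" if ij: "i < 3" "j < 3" "i \<noteq> j" for i j
    proof -
      have "B = A" if "B \<in> N i" "B \<in> N j" for B
      proof -
        have "B \<in> edges H" using that sub[OF ij(1)] by (auto simp: cover_def)
        moreover have "{a, b, c} \<subseteq> B"
          using that ij by (auto simp: N_def cover_def split: if_splits)
        ultimately show ?thesis by (rule only)
      qed
      moreover have "A \<notin> N i \<or> A \<notin> N j" using ij by (auto simp: N_def)
      ultimately show ?thesis by blast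
    qed
    have "has_berge 2 (cycle_graph 3) H"
      by (rule has_berge_cycleI[OF hH, where v = v and N = N and T = 6])
        (use N2 sub disj ne in \<open>auto simp: inj_on_def v_def\<close>)
    with nb show False by simp
  qed
  have "real (card (edges H)) \<le> 1 * real (card (verts H) choose 2)"
  proof (rule card_le_sum_of_pair_weights)
    show "finite (verts H)" "edges H \<subseteq> Pow (verts H)" using hH by (auto simp: hypergraph_def)
    show "1 \<le> (\<Sum>p | p \<subseteq> A \<and> card p = 2. w p)" if "A \<in> edges H" for A
    proof -
      have "card A = 3" using H that by (auto simp: uniform_def)
      then obtain a b c where abc: "A = {a, b, c}" "a \<noteq> b" "a \<noteq> c" "b \<noteq> c"
        by (auto simp: card_3_iff)
      have "{p. p \<subseteq> A \<and> card p = 2} = {{a, b}, {a, c}, {b, c}}"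
        using abc by (auto simp: card_2_iff)
      moreover have "{a, b} \<noteq> {a, c}" "{a, b} \<noteq> {b, c}" "{a, c} \<noteq> {b, c}"
        using abc by (auto simp: doubleton_eq_iff)
      ultimately have "(\<Sum>p | p \<subseteq> A \<and> card p = 2. w p) = w {a, b} + w {a, c} + w {b, c}" by simp
      moreover have "1 \<le> w {a, b} + w {a, c} + w {b, c}"
      proof -
        have "A = {b, a, c}" "A = {c, a, b}" using abc(1) by auto
        then have "\<not> (3 \<le> card (cover H {a, b}) \<and> 3 \<le> card (cover H {a, c}) \<and> 2 \<le> card (cover H {b, c}))"
          "\<not> (3 \<le> card (cover H {a, b}) \<and> 3 \<le> card (cover H {b, c}) \<and> 2 \<le> card (cover H {a, c}))"
          "\<not> (3 \<le> card (cover H {a, c}) \<and> 3 \<le> card (cover H {b, c}) \<and> 2 \<le> card (cover H {a, b}))"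
          using rich[of A a b c] rich[of A b a c] rich[of A c a b] abc that by (auto simp: insert_commute)
        then show ?thesis by (auto simp: w_def)
      qed
      ultimately show ?thesis by simp
    qed
    show "w p * card {A\<in>edges H. p \<subseteq> A} \<le> 1" for p
      by (auto simp: w_def simp flip: cover_def)
  qed
  then show ?thesis by simp
qed

section \<open>From Berge cycles to extremal numbers\<close>

text \<open>The only triangle that the bound on \<open>k\<close> admits is the one with
  \<open>r = 3\<close> and \<open>t = 2\<close>.\<close>

lemma berge_cycle_bound:
  fixes \<epsilon> :: real
  assumes "3 \<le> r" "2 \<le> t" "4 \<le> l \<or> l = 3 \<and> r = 3 \<and> t = 2" "\<epsilon> > 0"
  shows "\<exists>n0. \<forall>H :: 'a hypergraph. uniform r H \<longrightarrow> n0 \<le> card (verts H) \<longrightarrow>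
    \<not> has_berge t (cycle_graph l) H \<longrightarrow>
    real (card (edges H)) \<le> (real t - 1) * (card (verts H) choose 2) + \<epsilon> * (real (card (verts H)))\<^sup>2"
proof -
  consider "even l" "4 \<le> l" | "odd l" "5 \<le> l" | "l = 3" "r = 3" "t = 2"
  proof (cases "4 \<le> l")
    case True
    then show ?thesis using that by (cases "l = 4") force+
  qed (use assms(3) that in blast)
  then show ?thesis
  proof cases
    case 1
    then show ?thesis using berge_even_cycle_bound assms by blast
  next
    case 2
    then show ?thesis using berge_odd_cycle_bound assms by blast
  next
    case 3
    have "real (card (edges H)) \<le> (real t - 1) * (card (verts H) choose 2) + \<epsilon> * (real (card (verts H)))\<^sup>2"
      if "uniform r H" "\<not> has_berge t (cycle_graph l) H" for H :: "'a hypergraph"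
      using berge_triangle_bound[of H] that 3 assms(4) by (simp add: add_increasing2)
    then show ?thesis by blast
  qed
qed

text \<open>On the same vertex labels the edges of the path are edges of the cycle, so a witness
  restricts. Upper bounds for paths thus follow from those for cycles.\<close>

lemma has_berge_path_of_cycle:
  assumes "has_berge t (cycle_graph k) H"
  shows "has_berge t (path_graph k) H"
proof -
  have "{i, Suc i} \<in> edges (cycle_graph k)" if "Suc i < k" for i
    using that unfolding cycle_graph_def by (auto intro!: exI[of _ i])
  then have sub: "edges (path_graph k) \<subseteq> edges (cycle_graph k)" by (auto simp: path_graph_def)
  obtain i h where w: "heavy_witness t (cycle_graph k) H i h"
    "\<forall>e\<in>edges (cycle_graph k). \<forall>e'\<in>edges (cycle_graph k). e \<noteq> e' \<longrightarrow> h e \<inter> h e' = {}"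
    using assms unfolding has_berge_def by blast
  have "verts (path_graph k) = verts (cycle_graph k)" by (simp add: path_graph_def cycle_graph_def)
  then have "heavy_witness t (path_graph k) H i h"
    using w(1) sub unfolding heavy_witness_def by (metis subsetD)
  moreover have "\<forall>e\<in>edges (path_graph k). \<forall>e'\<in>edges (path_graph k). e \<noteq> e' \<longrightarrow> h e \<inter> h e' = {}"
    using w(2) sub by blast
  ultimately show ?thesis unfolding has_berge_def by blast
qed

text \<open>Keeping only the chosen hyperedges gives a member of the family: disjointness makes
  their number exactly \<open>t * card (edges F)\<close>.\<close>

lemma not_has_berge_of_free:
  fixes H :: "nat hypergraph"
  assumes H: "uniform r H" and F: "finite (edges F)" and free: "\<forall>G\<in>berge_family r t F. \<not> contains H G"
  shows "\<not> has_berge t F H"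
proof
  assume "has_berge t F H"
  then obtain i h where w: "heavy_witness t F H i h"
    and disj: "\<forall>e\<in>edges F. \<forall>e'\<in>edges F. e \<noteq> e' \<longrightarrow> h e \<inter> h e' = {}"
    unfolding has_berge_def by blast
  let ?G = "\<lparr>verts = verts H, edges = \<Union>e\<in>edges F. h e\<rparr>"
  have hH: "hypergraph H" using H uniform_def by blast
  have he: "h e \<subseteq> edges H" "card (h e) = t" if "e \<in> edges F" for e
    using w that by (auto simp: heavy_witness_def)
  have sub: "edges ?G \<subseteq> edges H" using he by auto
  have "\<forall>e\<in>edges F. finite (h e)" using he(1) finite_edges[OF hH] finite_subset by blast
  from card_UN_disjoint[OF F this disj] have "card (edges ?G) = (\<Sum>e\<in>edges F. card (h e))" by simp
  then have "card (edges ?G) = t * card (edges F)" using he by simp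
  moreover have "heavy_witness t F ?G i h"
    using w unfolding heavy_witness_def by auto
  moreover have "uniform r ?G"
    using H sub by (auto simp: uniform_def hypergraph_def)
  ultimately have "?G \<in> berge_family r t F"
    using disj unfolding berge_family_def berge_copy_def uniform_def by blast
  moreover have "contains H ?G" unfolding contains_def using sub by (intro exI[of _ id]) auto
  ultimately show False using free by blast
qed

lemma berge_family_subset_heavy_family: "berge_family r t F \<subseteq> heavy_family r t F"
  by (auto simp: berge_family_def heavy_family_def berge_copy_def heavy_copy_def)

text \<open>Guarantees that the maximum defining \<open>ex\<close> is taken over a nonempty
  set.\<close>

lemma heavy_family_edges_nonempty:
  assumes "G \<in> heavy_family r t F" "edges F \<noteq> {}" "1 \<le> t"
  shows "edges G \<noteq> {}"
proof -
  obtain i h where "heavy_witness t F G i h"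
    using assms by (auto simp: heavy_family_def heavy_copy_def)
  moreover obtain e where "e \<in> edges F" using assms by auto
  ultimately have "h e \<subseteq> edges G" "card (h e) = t" by (auto simp: heavy_witness_def)
  then show ?thesis using assms(3) by auto
qed

lemma ex_attained:
  assumes "\<And>G. G \<in> \<F> \<Longrightarrow> edges G \<noteq> {}"
  obtains H :: "nat hypergraph" where "uniform r H" "card (verts H) = n" "\<forall>G\<in>\<F>. \<not> contains H G" "ex r n \<F> = card (edges H)"
proof -
  have "ex r n \<F> \<in> {card (edges H) | H :: nat hypergraph.
     uniform r H \<and> card (verts H) = n \<and> (\<forall>G\<in>\<F>. \<not> contains H G)}"
    unfolding ex_def by (rule Max_in[OF finite_ex_set ex_set_nonempty[OF assms]])
  then show ?thesis using that by blast
qed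

lemma ex_ge:
  fixes H :: "nat hypergraph"
  assumes "uniform r H" "card (verts H) = n" "\<forall>G\<in>\<F>. \<not> contains H G"
  shows "card (edges H) \<le> ex r n \<F>"
  unfolding ex_def using assms by (intro Max_ge finite_ex_set CollectI exI[of _ H]) simp

lemma ex_antimono:
  assumes "\<F> \<subseteq> \<G>" "\<And>G. G \<in> \<G> \<Longrightarrow> edges G \<noteq> {}"
  shows "ex r n \<G> \<le> ex r n \<F>"
proof -
  obtain H :: "nat hypergraph" where "uniform r H" "card (verts H) = n" "\<forall>G\<in>\<G>. \<not> contains H G" "ex r n \<G> = card (edges H)"
    using ex_attained assms(2) by metis
  then show ?thesis using ex_ge[of r H n \<F>] assms(1) by auto
qed

section \<open>The extremal construction\<close>

text \<open>Blocks are consecutive intervals, so lying outside all of them is the inequality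
  \<open>m * b \<le> x\<close>. The application has \<open>b = r - 2\<close> and
  \<open>m = t - 1\<close>.\<close>

definition block_hypergraph :: "nat \<Rightarrow> nat \<Rightarrow> nat \<Rightarrow> nat hypergraph" where
  "block_hypergraph b m n = \<lparr>verts = {..<n},
     edges = (\<lambda>(g, p). {g * b..<Suc g * b} \<union> p) ` ({..<m} \<times> {p. p \<subseteq> {m * b..<n} \<and> card p = 2})\<rparr>"

lemma block_subset:
  fixes b :: nat
  assumes "g < m"
  shows "{g * b..<Suc g * b} \<subseteq> {..<m * b}"
proof -
  have "Suc g * b \<le> m * b" using assms by (intro mult_le_mono1) simp
  then show ?thesis by (meson atLeastLessThan_iff lessThan_iff less_le_trans subsetI)
qed

lemma uniform_block_hypergraph:
  assumes "m * b \<le> n"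
  shows "uniform (b + 2) (block_hypergraph b m n)"
proof -
  have "A \<subseteq> {..<n} \<and> card A = b + 2" if "A \<in> edges (block_hypergraph b m n)" for A
  proof -
    obtain g p where gp: "g < m" "p \<subseteq> {m * b..<n}" "card p = 2" "A = {g * b..<Suc g * b} \<union> p"
      using \<open>A \<in> _\<close> by (auto simp: block_hypergraph_def)
    have g: "{g * b..<Suc g * b} \<subseteq> {..<m * b}" by (rule block_subset[OF gp(1)])
    then have "{g * b..<Suc g * b} \<inter> p = {}" using gp(2) by fastforce
    moreover have "finite p" using gp(2) finite_subset by blast
    ultimately have "card A = card {g * b..<Suc g * b} + card p" using gp(4) card_Un_disjoint by blast
    also have "\<dots> = b + 2" using gp(3) by simp
    finally show ?thesis using gp g assms by fastforce
  qed
  moreover have "verts (block_hypergraph b m n) = {..<n}" by (simp add: block_hypergraph_def)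
  ultimately show ?thesis unfolding uniform_def hypergraph_def by auto
qed

text \<open>A hyperedge determines its block and its pair by intersection with the vertices below
  and from \<open>m * b\<close>; nonempty blocks are distinct.\<close>

lemma card_edges_block_hypergraph:
  assumes "1 \<le> b"
  shows "card (edges (block_hypergraph b m n)) = m * (n - m * b choose 2)"
proof -
  let ?P = "{p. p \<subseteq> {m * b..<n} \<and> card p = 2}"
  have "inj_on (\<lambda>(g, p). {g * b..<Suc g * b} \<union> p) ({..<m} \<times> ?P)"
  proof (rule inj_onI, clarify)
    fix g p g' p'
    assume g: "g < m" "g' < m" and p: "p \<subseteq> {m * b..<n}" "p' \<subseteq> {m * b..<n}"
      and eq: "{g * b..<Suc g * b} \<union> p = {g' * b..<Suc g' * b} \<union> p'"
    have sub: "{g * b..<Suc g * b} \<subseteq> {..<m * b}" "{g' * b..<Suc g' * b} \<subseteq> {..<m * b}"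
      using block_subset g by blast+
    have dis: "{..<m * b} \<inter> {m * b..<n} = {}" by auto
    have "p = ({g * b..<Suc g * b} \<union> p) \<inter> {m * b..<n}" using sub p dis by blast
    also have "\<dots> = p'" unfolding eq using sub p dis by blast
    finally have "p = p'" .
    have "{g * b..<Suc g * b} = ({g * b..<Suc g * b} \<union> p) \<inter> {..<m * b}" using sub p dis by blast
    also have "\<dots> = {g' * b..<Suc g' * b}" unfolding eq using sub p dis by blast
    finally have "g * b = g' * b" using assms by (simp add: atLeastLessThan_eq_iff)
    then show "g = g' \<and> p = p'" using \<open>p = p'\<close> assms by simp
  qed
  then have "card (edges (block_hypergraph b m n)) = card ({..<m} \<times> ?P)"
    by (simp add: block_hypergraph_def card_image)
  also have "\<dots> = m * (n - m * b choose 2)"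
    using n_subsets[of "{m * b..<n}" 2] by (simp add: card_cartesian_product)
  finally show ?thesis .
qed

text \<open>Both vertices must belong to the outside pair of the hyperedge, so only the block
  remains to be chosen.\<close>

lemma block_hypergraph_codegree:
  assumes "x \<noteq> y" "m * b \<le> x" "m * b \<le> y"
  shows "card (cover (block_hypergraph b m n) {x, y}) \<le> m"
proof -
  have "cover (block_hypergraph b m n) {x, y} \<subseteq> (\<lambda>g. {g * b..<Suc g * b} \<union> {x, y}) ` {..<m}"
  proof
    fix A assume "A \<in> cover (block_hypergraph b m n) {x, y}"
    then obtain g p where gp: "g < m" "p \<subseteq> {m * b..<n}" "card p = 2" "A = {g * b..<Suc g * b} \<union> p"
      and xy: "x \<in> A" "y \<in> A"
      by (auto simp: block_hypergraph_def cover_def)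
    have "x \<notin> {g * b..<Suc g * b}" "y \<notin> {g * b..<Suc g * b}"
      using block_subset[OF gp(1), of b] assms(2,3) by (meson lessThan_iff not_less subsetD)+
    then have "{x, y} \<subseteq> p" using xy gp(4) by blast
    moreover have "finite p" using gp(2) finite_subset by blast
    ultimately have "p = {x, y}" using gp(3) assms(1) card_subset_eq[of p "{x, y}"] by simp
    then show "A \<in> (\<lambda>g. {g * b..<Suc g * b} \<union> {x, y}) ` {..<m}" using gp by blast
  qed
  then have "card (cover (block_hypergraph b m n) {x, y}) \<le> card {..<m}"
    by (rule surj_card_le[OF finite_lessThan])
  then show ?thesis by simp
qed

text \<open>The embedding of \<open>G\<close> is injective on sets of vertices, so \<open>t\<close>
  distinct hyperedges over an edge remain distinct in \<open>H\<close>.\<close>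

lemma heavy_copy_codegrees:
  assumes H: "hypergraph H" and G: "G \<in> heavy_family r t F" and "contains H G"
  obtains j where "inj_on j (verts F)" "\<And>x y. {x, y} \<in> edges F \<Longrightarrow> t \<le> card (cover H {j x, j y})"
proof -
  obtain f where f: "inj_on f (verts G)" "f ` verts G \<subseteq> verts H" "(`) f ` edges G \<subseteq> edges H"
    using assms(3) by (auto simp: contains_def)
  obtain i h where w: "heavy_witness t F G i h" and hG: "hypergraph G"
    using G by (auto simp: heavy_family_def heavy_copy_def)
  have "inj_on (f \<circ> i) (verts F)"
    using w f(1) by (intro comp_inj_on) (auto simp: heavy_witness_def intro: inj_on_subset)
  moreover have "t \<le> card (cover H {(f \<circ> i) x, (f \<circ> i) y})" if e: "{x, y} \<in> edges F" for x y
  proof -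
    have h: "h {x, y} \<subseteq> edges G" "card (h {x, y}) = t" "\<And>A. A \<in> h {x, y} \<Longrightarrow> {i x, i y} \<subseteq> A"
      using w e by (auto simp: heavy_witness_def)
    then have "inj_on ((`) f) (h {x, y})"
      using hG by (intro inj_on_subset[OF inj_on_image_Pow[OF f(1)]]) (auto simp: hypergraph_def)
    then have "card ((`) f ` h {x, y}) = t" using h(2) by (simp add: card_image)
    moreover have "(`) f ` h {x, y} \<subseteq> cover H {(f \<circ> i) x, (f \<circ> i) y}"
    proof
      fix B assume "B \<in> (`) f ` h {x, y}"
      then obtain A where A: "A \<in> h {x, y}" "B = f ` A" by auto
      then show "B \<in> cover H {(f \<circ> i) x, (f \<circ> i) y}"
        using h(1) h(3)[OF A(1)] f(3) by (auto simp: cover_def)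
    qed
    ultimately show ?thesis using card_mono[OF finite_cover[OF H]] by metis
  qed
  ultimately show ?thesis by (rule that)
qed

text \<open>Only edges meeting the \<open>m * b\<close> block vertices can be heavy, and \<open>l > 2 * m * b\<close> edges in
  which every vertex has degree at most 2 have no vertex cover of size \<open>m * b\<close>.\<close>

lemma block_hypergraph_heavy_free:
  assumes n: "m * b \<le> n" and F: "\<And>i. i < l \<Longrightarrow> {i, \<sigma> i} \<in> edges F \<and> {i, \<sigma> i} \<subseteq> verts F \<and> i \<noteq> \<sigma> i"
    and inj: "inj_on \<sigma> {..<l}" and l: "2 * (m * b) < l" and t: "m < t"
  shows "\<forall>G\<in>heavy_family r t F. \<not> contains (block_hypergraph b m n) G"
proof (intro ballI notI)
  fix G assume G: "G \<in> heavy_family r t F" "contains (block_hypergraph b m n) G"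
  have "hypergraph (block_hypergraph b m n)" using uniform_block_hypergraph[OF n] uniform_def by blast
  from heavy_copy_codegrees[OF this G] obtain j where j: "inj_on j (verts F)"
    "\<And>x y. {x, y} \<in> edges F \<Longrightarrow> t \<le> card (cover (block_hypergraph b m n) {j x, j y})" by blast
  define S where "S = {x\<in>verts F. j x < m * b}"
  have jS: "inj_on j S" "j ` S \<subseteq> {..<m * b}" using j(1) by (auto simp: S_def inj_on_def)
  then have finS: "finite S" using inj_on_finite by blast
  have cS: "card S \<le> m * b" using card_inj_on_le[OF jS] by simp
  have "i \<in> S \<or> \<sigma> i \<in> S" if "i < l" for i
  proof (rule ccontr)
    assume "\<not> ?thesis"
    then have "m * b \<le> j i" "m * b \<le> j (\<sigma> i)" using F[OF that] by (auto simp: S_def)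
    moreover have "j i \<noteq> j (\<sigma> i)" using F[OF that] inj_onD[OF j(1), of i "\<sigma> i"] by auto
    ultimately show False using block_hypergraph_codegree[of "j i" "j (\<sigma> i)" m b n] j(2)[of i "\<sigma> i"] F[OF that] t
      by simp
  qed
  \<comment> \<open>Since \<open>\<sigma>\<close> is injective, a vertex of \<open>S\<close>
    accounts for at most two indices, once as first and once as second end.\<close>
  then have "{..<l} \<subseteq> S \<union> {i\<in>{..<l}. \<sigma> i \<in> S}" by auto
  then have "card {..<l} \<le> card (S \<union> {i\<in>{..<l}. \<sigma> i \<in> S})" using finS by (intro card_mono) auto
  also have "\<dots> \<le> card S + card {i\<in>{..<l}. \<sigma> i \<in> S}" by (rule card_Un_le)
  also have "card {i\<in>{..<l}. \<sigma> i \<in> S} \<le> card S"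
    using inj finS by (intro card_inj_on_le[of \<sigma>]) (auto simp: inj_on_def)
  finally show False using cS l by simp
qed

section \<open>Asymptotics\<close>

lemma real_choose_two: "real (n choose 2) = real n * (real n - 1) / 2"
proof (induction n)
  case (Suc n)
  have "Suc n choose 2 = n + (n choose 2)" by (simp add: numeral_2_eq_2)
  then show ?case using Suc by (simp add: field_simps)
qed simp

text \<open>For \<open>n \<ge> 2\<close> the equation forces \<open>\<epsilon>\<close>. It tends to
  0 because shifting \<open>n\<close> by the constant \<open>s\<close> does not change the leading
  term of the binomial coefficient.\<close>

lemma asymptotic_choose_two:
  fixes a :: "nat \<Rightarrow> nat" and c :: real
  assumes c: "0 \<le> c" and lower: "\<And>n. s \<le> n \<Longrightarrow> c * (n - s choose 2) \<le> a n"
    and upper: "\<And>e :: real. e > 0 \<Longrightarrow> \<exists>n0. \<forall>n\<ge>n0. a n \<le> c * (n choose 2) + e * (real n)\<^sup>2"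
  shows "\<exists>\<epsilon> :: nat \<Rightarrow> real. \<epsilon> \<in> o(\<lambda>n. 1) \<and>
    (\<forall>\<^sub>F n in sequentially. real (a n) = (c - \<epsilon> n) * real (n choose 2))"
proof -
  define \<epsilon> where "\<epsilon> n = c - a n / real (n choose 2)" for n
  have pos: "0 < n choose 2" if "2 \<le> n" for n using that by simp
  have "\<epsilon> \<longlonglongrightarrow> 0"
  proof (rule LIMSEQ_I)
    fix \<eta> :: real assume \<eta>: "\<eta> > 0"
    \<comment> \<open>As \<open>n ^ 2\<close> is at most four times the binomial coefficient,
      \<open>\<eta> / 8\<close> becomes a relative error of \<open>\<eta> / 2\<close>.\<close>
    obtain n1 where n1: "\<And>n. n \<ge> n1 \<Longrightarrow> a n \<le> c * (n choose 2) + \<eta> / 8 * (real n)\<^sup>2"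
      using upper[of "\<eta> / 8"] \<eta> by auto
    have "(\<lambda>n. c - c * ((real n - real s) * (real n - real s - 1) / 2) / (real n * (real n - 1) / 2)) \<longlonglongrightarrow> 0"
      by real_asymp
    then obtain n2 where n2: "\<And>n. n \<ge> n2 \<Longrightarrow>
        \<bar>c - c * ((real n - real s) * (real n - real s - 1) / 2) / (real n * (real n - 1) / 2)\<bar> < \<eta>"
      using LIMSEQ_D[OF _ \<eta>] by fastforce
    have "norm (\<epsilon> n - 0) < \<eta>" if "n \<ge> max (max n1 n2) (s + 2)" for n
    proof -
      have n: "n \<ge> n1" "n \<ge> n2" "n \<ge> s" "n \<ge> 2" using that by auto
      let ?c = "real (n choose 2)"
      have cp: "0 < ?c" using pos n(4) by simp
      have "(real n)\<^sup>2 \<le> 4 * ?c"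
      proof -
        have "real n * real n \<le> real n * (2 * (real n - 1))" using n(4) by (intro mult_left_mono) auto
        then show ?thesis by (simp add: real_choose_two power2_eq_square algebra_simps)
      qed
      then have "\<eta> / 8 * (real n)\<^sup>2 \<le> \<eta> / 8 * (4 * ?c)" using \<eta> by (intro mult_left_mono) auto
      then have "a n \<le> (c + \<eta> / 2) * ?c" using n1[OF n(1)] by (simp add: algebra_simps)
      then have "a n / ?c \<le> c + \<eta> / 2" using cp by (simp add: divide_le_eq)
      then have "- \<eta> < \<epsilon> n" using \<eta> by (simp add: \<epsilon>_def)
      have "real (n - s choose 2) = (real n - real s) * (real n - real s - 1) / 2"
        using n(3) by (simp add: real_choose_two of_nat_diff)
      then have "c - c * (n - s choose 2) / ?c < \<eta>" using n2[OF n(2)] by (simp add: real_choose_two)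
      moreover have "c * (n - s choose 2) / ?c \<le> a n / ?c"
        using lower[OF n(3)] cp by (intro divide_right_mono) auto
      ultimately have "\<epsilon> n < \<eta>" by (simp add: \<epsilon>_def)
      with \<open>- \<eta> < \<epsilon> n\<close> show ?thesis by simp
    qed
    then show "\<exists>no. \<forall>n\<ge>no. norm (\<epsilon> n - 0) < \<eta>" by blast
  qed
  then have "\<epsilon> \<in> o(\<lambda>n. 1)" by (intro smalloI_tendsto) simp_all
  moreover have "\<forall>\<^sub>F n in sequentially. real (a n) = (c - \<epsilon> n) * real (n choose 2)"
    \<comment> \<open>Below 2 the binomial coefficient is 0 and the division in
      \<open>\<epsilon>\<close> does not cancel.\<close>
    using eventually_ge_at_top[of 2]
  proof eventually_elim
    case (elim n)
    then show ?case using pos[OF elim] by (simp add: \<epsilon>_def)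
  qed
  ultimately show ?thesis by blast
qed

text \<open>Both extremal numbers are squeezed: the construction bounds the heavy one from below,
  Berge cycles of length \<open>c\<close> bound the Berge one from above, and the smaller Berge
  family has the larger extremal number. The map \<open>\<sigma>\<close> sends an edge index to its
  second end.\<close>

lemma ex_asymptotics:
  assumes r: "3 \<le> r" and t: "2 \<le> t" and c: "4 \<le> c \<or> c = 3 \<and> r = 3 \<and> t = 2"
    and F: "\<And>i. i < l \<Longrightarrow> {i, \<sigma> i} \<in> edges F \<and> {i, \<sigma> i} \<subseteq> verts F \<and> i \<noteq> \<sigma> i"
    and inj: "inj_on \<sigma> {..<l}" and l: "2 * ((t - 1) * (r - 2)) < l" and finF: "finite (edges F)"
    and sub: "\<And>H :: nat hypergraph. has_berge t (cycle_graph c) H \<Longrightarrow> has_berge t F H"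
  shows "\<exists>\<epsilon> :: nat \<Rightarrow> real. \<epsilon> \<in> o(\<lambda>n. 1) \<and> (\<forall>\<^sub>F n in sequentially.
        real (ex r n (heavy_family r t F)) = (real t - 1 - \<epsilon> n) * real (n choose 2))" (is ?heavy)
    and "\<exists>\<epsilon> :: nat \<Rightarrow> real. \<epsilon> \<in> o(\<lambda>n. 1) \<and> (\<forall>\<^sub>F n in sequentially.
        real (ex r n (berge_family r t F)) = (real t - 1 - \<epsilon> n) * real (n choose 2))" (is ?berge)
proof -
  have "edges F \<noteq> {}" using F[of 0] l by auto
  then have heavy_ne: "edges G \<noteq> {}" if "G \<in> heavy_family r t F" for G
    using heavy_family_edges_nonempty that t by (metis le_trans one_le_numeral)
  then have berge_ne: "edges G \<noteq> {}" if "G \<in> berge_family r t F" for G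
    using berge_family_subset_heavy_family that by blast
  have mono: "ex r n (heavy_family r t F) \<le> ex r n (berge_family r t F)" for n
    using berge_family_subset_heavy_family heavy_ne by (intro ex_antimono)
  have lower: "(real t - 1) * (n - (t - 1) * (r - 2) choose 2) \<le> ex r n (heavy_family r t F)"
    if n: "(t - 1) * (r - 2) \<le> n" for n
  proof -
    let ?H = "block_hypergraph (r - 2) (t - 1) n"
    have "card (edges ?H) \<le> ex r n (heavy_family r t F)"
    proof (rule ex_ge)
      show "uniform r ?H" using uniform_block_hypergraph[OF n] r by (metis add_leD1 le_add_diff_inverse2 numeral_3_eq_3 numeral_2_eq_2 Suc_leD)
      show "card (verts ?H) = n" by (simp add: block_hypergraph_def)
      show "\<forall>G\<in>heavy_family r t F. \<not> contains ?H G"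
        by (rule block_hypergraph_heavy_free[OF n F inj l]) (use t in simp_all)
    qed
    moreover have "card (edges ?H) = (t - 1) * (n - (t - 1) * (r - 2) choose 2)"
      using r by (intro card_edges_block_hypergraph) simp
    ultimately have "(t - 1) * (n - (t - 1) * (r - 2) choose 2) \<le> ex r n (heavy_family r t F)"
      by simp
    then have "real ((t - 1) * (n - (t - 1) * (r - 2) choose 2)) \<le> ex r n (heavy_family r t F)"
      by (rule of_nat_mono)
    then show ?thesis using t by (simp add: of_nat_diff)
  qed
  have upper: "\<exists>n0. \<forall>n\<ge>n0. ex r n (berge_family r t F) \<le> (real t - 1) * (n choose 2) + e * (real n)\<^sup>2"
    if e: "e > 0" for e :: real
  proof -
    obtain n0 where n0: "\<And>H :: nat hypergraph. uniform r H \<Longrightarrow> n0 \<le> card (verts H) \<Longrightarrow>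
      \<not> has_berge t (cycle_graph c) H \<Longrightarrow>
      real (card (edges H)) \<le> (real t - 1) * (card (verts H) choose 2) + e * (real (card (verts H)))\<^sup>2"
      using berge_cycle_bound[OF r t c e, where 'a = nat] by auto
    have "ex r n (berge_family r t F) \<le> (real t - 1) * (n choose 2) + e * (real n)\<^sup>2" if n: "n \<ge> n0" for n
    proof -
      obtain H :: "nat hypergraph" where H: "uniform r H" "card (verts H) = n"
        "\<forall>G\<in>berge_family r t F. \<not> contains H G" "ex r n (berge_family r t F) = card (edges H)"
        by (rule ex_attained[OF berge_ne])
      have "\<not> has_berge t (cycle_graph c) H" using not_has_berge_of_free[OF H(1) finF H(3)] sub by (rule contrapos_nn)
      with n0[OF H(1)] H n show ?thesis by simp
    qed
    then show ?thesis by blast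
  qed
  show ?berge
  proof (rule asymptotic_choose_two)
    show "(real t - 1) * (n - (t - 1) * (r - 2) choose 2) \<le> ex r n (berge_family r t F)"
      if "(t - 1) * (r - 2) \<le> n" for n
      using lower[OF that] mono[of n] by linarith
  qed (use t upper in auto)
  show ?heavy
  proof (rule asymptotic_choose_two)
    show "\<exists>n0. \<forall>n\<ge>n0. ex r n (heavy_family r t F) \<le> (real t - 1) * (n choose 2) + e * (real n)\<^sup>2"
      if "e > 0" for e :: real
      using upper[OF that] mono by (meson of_nat_le_iff order_trans)
  qed (use t lower in auto)
qed

theorem theorem2:
  fixes r t k :: nat
  assumes "r \<ge> 3" and "t \<ge> 2" and "k \<ge> 2 * (t - 1) * (r - 2) + 2"
  shows
    "(\<exists>\<epsilon> :: nat \<Rightarrow> real. \<epsilon> \<in> o(\<lambda>n. 1) \<and> (\<forall>\<^sub>F n in sequentially.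
        real (ex r n (heavy_family r t (path_graph k))) = (real t - 1 - \<epsilon> n) * real (n choose 2))) \<and>
     (\<exists>\<epsilon> :: nat \<Rightarrow> real. \<epsilon> \<in> o(\<lambda>n. 1) \<and> (\<forall>\<^sub>F n in sequentially.
        real (ex r n (berge_family r t (path_graph k))) = (real t - 1 - \<epsilon> n) * real (n choose 2))) \<and>
     (\<exists>\<epsilon> :: nat \<Rightarrow> real. \<epsilon> \<in> o(\<lambda>n. 1) \<and> (\<forall>\<^sub>F n in sequentially.
        real (ex r n (heavy_family r t (cycle_graph (k - 1)))) = (real t - 1 - \<epsilon> n) * real (n choose 2))) \<and>
     (\<exists>\<epsilon> :: nat \<Rightarrow> real. \<epsilon> \<in> o(\<lambda>n. 1) \<and> (\<forall>\<^sub>F n in sequentially.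
        real (ex r n (berge_family r t (cycle_graph (k - 1)))) = (real t - 1 - \<epsilon> n) * real (n choose 2)))"
proof -
  let ?s = "(t - 1) * (r - 2)"
  have s: "2 * ?s + 2 \<le> k" using assms(3) by (simp add: mult.assoc)
  have "t - 1 \<le> ?s" "r - 2 \<le> ?s" "1 \<le> ?s" using assms(1,2) by auto
  then have k: "4 \<le> k" using s by linarith
  \<comment> \<open>For \<open>k = 4\<close> the product \<open>?s\<close> is at most 1, and so are
    both of its factors.\<close>
  have "k = 4 \<Longrightarrow> r = 3 \<and> t = 2" using s \<open>t - 1 \<le> ?s\<close> \<open>r - 2 \<le> ?s\<close> assms(1,2) by linarith
  then have c: "4 \<le> k - 1 \<or> k - 1 = 3 \<and> r = 3 \<and> t = 2" using k by linarith
  have lt: "2 * ?s < k - 1" using s by linarith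
  have pathE: "edges (path_graph k) = (\<lambda>i. {i, Suc i}) ` {..<k - 1}"
    by (auto simp: path_graph_def)
  have cycleE: "edges (cycle_graph l) = (\<lambda>i. {i, Suc i mod l}) ` {..<l}" for l
    by (auto simp: cycle_graph_def)
  have path: "{i, Suc i} \<in> edges (path_graph k) \<and> {i, Suc i} \<subseteq> verts (path_graph k) \<and> i \<noteq> Suc i"
    if "i < k - 1" for i
    using that by (auto simp: path_graph_def)
  have cycle: "{i, Suc i mod (k - 1)} \<in> edges (cycle_graph (k - 1)) \<and>
      {i, Suc i mod (k - 1)} \<subseteq> verts (cycle_graph (k - 1)) \<and> i \<noteq> Suc i mod (k - 1)"
    if "i < k - 1" for i
    using that k by (auto simp: cycleE mod_Suc) (auto simp: cycle_graph_def)
  have inj: "inj_on (\<lambda>i. Suc i mod (k - 1)) {..<k - 1}"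
    by (auto simp: inj_on_def mod_Suc split: if_splits)
  have fin: "finite (edges (path_graph k))" "finite (edges (cycle_graph (k - 1)))"
    by (simp_all add: pathE cycleE)
  have injS: "inj_on Suc {..<k - 1}" by simp
  \<comment> \<open>The path is found in a Berge cycle on all \<open>k\<close> vertices; for the
    cycle on \<open>k - 1\<close> vertices the required implication is trivial.\<close>
  note P = ex_asymptotics[where \<sigma> = Suc and F = "path_graph k" and l = "k - 1",
    OF assms(1,2) disjI1[OF k] path injS lt fin(1) has_berge_path_of_cycle]
  note C = ex_asymptotics[where \<sigma> = "\<lambda>i. Suc i mod (k - 1)" and F = "cycle_graph (k - 1)" and l = "k - 1",
    OF assms(1,2) c cycle inj lt fin(2)]
  show ?thesis
    by (intro conjI P C)
qed

end
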